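(* Let $S$ be a smooth manifold and $K=\partial_t$ on $\mathbb{R}\times S$. Define the map $\Psi:\mathrm{SOM}(\mathbb{R}\times S)\to\mathrm{Stat}_R(\mathbb{R}\times S)$, $g_L\mapsto g_R$, by $$g_R(w,w)=g_L(w,w)-2\,\frac{g_L(w,K)^2}{g_L(K,K)},\qquad w\in T(\mathbb{R}\times S).$$ Then $\Psi$ is one-to-one (a bijection), with inverse given by $$g_L(w,w)=g_R(w,w)-2\,\frac{g_R(w,K)^2}{g_R(K,K)},$$ and, whenever $g_R=\Psi(g_L)$: (i) the metrics $g_L$ and $g_R$ share the same Killing vector field $K=\partial_t$, but with $g_L(K,K)=-g_R(K,K)$; (ii) both metrics have the same values on the orthogonal subspace to $K$; (iii) the sets of conformal maps of $g_R$ and of $g_L$ which preserve the Killing vector field $K$ coincide.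
   Context: $\mathrm{SOM}(\mathbb{R}\times S)$ is the set of Lorentzian metrics on $\mathbb{R}\times S$ of the form $g=-\beta\,dt\otimes dt+dt\otimes\omega+\omega\otimes dt+g_0$, where $\beta:S\to(0,\infty)$ is a smooth function, $\omega$ a one-form on $S$, $g_0$ a symmetric $(0,2)$-tensor on $S$, and $g_0(v,v)+\frac1\beta\omega(v)^2>0$ for every nonzero $v\in TS$. $\mathrm{Stat}_R(\mathbb{R}\times S)$ is the set of Riemannian metrics on $\mathbb{R}\times S$ having $K=\partial_t$ as a Killing field; equivalently, those of the form $g_R((\tau,v),(\tau,v))=\bar g_0(v,v)+2\bar\omega(v)\tau+\bar\beta\tau^2$ with $\bar\beta$ a positive function on $S$, $\bar\omega$ a one-form and $\bar g_0$ a symmetric $(0,2)$-tensor on $S$ satisfying $\bar g_0(v,v)-\bar\omega(v)^2/\bar\beta>0$ for all nonzero $v\in TS$. A conformal map of a metric $g$ is a diffeomorphism $\psi$ of $\mathbb{R}\times S$ with $\psi^*g=\lambda g$ for a positive function $\lambda$; it preserves $K$ if $d\psi(K)=K$. *)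

theory Defs
  imports "HOL-Analysis.Analysis"
begin

text \<open>
  Manifolds are Hausdorff, second countable types with a smooth atlas modelled on a Euclidean space
  (without boundary, all components of the same positive dimension).
  Up to canonical identification, the notions below depend only on the smooth structure, not on the
  atlas chosen for it.
\<close>

section \<open>Smooth functions on open subsets of Euclidean spaces\<close>

primrec Ck_on :: "nat \<Rightarrow> 'a::euclidean_space set \<Rightarrow> ('a \<Rightarrow> 'b::euclidean_space) \<Rightarrow> bool" where
  "Ck_on 0 U f \<longleftrightarrow> continuous_on U f"
| "Ck_on (Suc k) U f \<longleftrightarrow>
     (\<forall>x\<in>U. f differentiable (at x)) \<and> (\<forall>v. Ck_on k U (\<lambda>x. frechet_derivative f (at x) v))"

definition smooth_on :: "'a::euclidean_space set \<Rightarrow> ('a \<Rightarrow> 'b::euclidean_space) \<Rightarrow> bool" where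
  "smooth_on U f \<longleftrightarrow> (\<forall>k. Ck_on k U f)"

section \<open>Charts, atlases, smooth maps\<close>

text \<open>A chart is a domain with a coordinate map; the map is irrelevant outside of the domain.\<close>

type_synonym ('m, 'e) chart = "'m set \<times> ('m \<Rightarrow> 'e)"

definition cdom :: "('m, 'e) chart \<Rightarrow> 'm set" where
  "cdom c = fst c"

definition coord :: "('m, 'e) chart \<Rightarrow> 'm \<Rightarrow> 'e" where
  "coord c = snd c"

definition cimg :: "('m, 'e) chart \<Rightarrow> 'e set" where
  "cimg c = coord c ` cdom c"

definition cinv :: "('m, 'e) chart \<Rightarrow> 'e \<Rightarrow> 'm" where
  "cinv c = inv_into (cdom c) (coord c)"

definition is_chart :: "('m::topological_space, 'e::euclidean_space) chart \<Rightarrow> bool" where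
  "is_chart c \<longleftrightarrow>
     open (cdom c) \<and> open (cimg c) \<and> homeomorphism (cdom c) (cimg c) (coord c) (cinv c)"

definition smooth_atlas :: "('m::topological_space, 'e::euclidean_space) chart set \<Rightarrow> bool" where
  "smooth_atlas A \<longleftrightarrow>
     (\<forall>c\<in>A. is_chart c) \<and> (\<Union>c\<in>A. cdom c) = UNIV \<and>
     (\<forall>c\<in>A. \<forall>d\<in>A. smooth_on (coord c ` (cdom c \<inter> cdom d)) (coord d \<circ> cinv c))"

definition charts_at :: "('m, 'e) chart set \<Rightarrow> 'm \<Rightarrow> ('m, 'e) chart set" where
  "charts_at A p = {c \<in> A. p \<in> cdom c}"

definition line_atlas :: "(real, real) chart set" where
  "line_atlas = {(UNIV, \<lambda>t. t)}"

definition prod_atlas ::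
  "('m, 'e) chart set \<Rightarrow> ('n, 'f) chart set \<Rightarrow> ('m \<times> 'n, 'e \<times> 'f) chart set" where
  "prod_atlas A B = {(cdom c \<times> cdom d, map_prod (coord c) (coord d)) | c d. c \<in> A \<and> d \<in> B}"

definition smooth_fun :: "('m, 'e::euclidean_space) chart set \<Rightarrow> ('m \<Rightarrow> real) \<Rightarrow> bool" where
  "smooth_fun A f \<longleftrightarrow> (\<forall>c\<in>A. smooth_on (cimg c) (f \<circ> cinv c))"

definition smooth_map ::
  "('m::topological_space, 'e::euclidean_space) chart set \<Rightarrow>
   ('n::topological_space, 'f::euclidean_space) chart set \<Rightarrow> ('m \<Rightarrow> 'n) \<Rightarrow> bool" where
  "smooth_map A B f \<longleftrightarrow> continuous_on UNIV f \<and>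
     (\<forall>c\<in>A. \<forall>d\<in>B. smooth_on (coord c ` (cdom c \<inter> f -` cdom d)) (coord d \<circ> f \<circ> cinv c))"

definition diffeomorphism ::
  "('m::topological_space, 'e::euclidean_space) chart set \<Rightarrow> ('m \<Rightarrow> 'm) \<Rightarrow> bool" where
  "diffeomorphism A f \<longleftrightarrow> bij f \<and> smooth_map A A f \<and> smooth_map A A (inv f)"

section \<open>Tangent vectors\<close>

text \<open>
  A tangent vector at \<open>p\<close> is the family of its component vectors in the charts around \<open>p\<close>, related
  by the derivatives of the coordinate changes. The entry at any other index is \<open>0\<close>, so that
  equality of tangent vectors is equality of functions. The vector space operations are pointwise.
\<close>

type_synonym ('m, 'e) tvector = "('m, 'e) chart \<Rightarrow> 'e"

definition tangent_space ::
  "('m, 'e::euclidean_space) chart set \<Rightarrow> 'm \<Rightarrow> ('m, 'e) tvector set" where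
  "tangent_space A p =
     {v. (\<forall>c. c \<notin> charts_at A p \<longrightarrow> v c = 0) \<and>
         (\<forall>c\<in>charts_at A p. \<forall>d\<in>charts_at A p.
            v d = frechet_derivative (coord d \<circ> cinv c) (at (coord c p)) (v c))}"

text \<open>The tangent vector at \<open>p\<close> whose component vector in the chart \<open>c\<close> is \<open>a\<close>:\<close>

definition coord_vector ::
  "('m, 'e::euclidean_space) chart set \<Rightarrow> ('m, 'e) chart \<Rightarrow> 'm \<Rightarrow> 'e \<Rightarrow> ('m, 'e) tvector" where
  "coord_vector A c p a =
     (\<lambda>d. if d \<in> charts_at A p then frechet_derivative (coord d \<circ> cinv c) (at (coord c p)) a else 0)"

text \<open>The differential; the result does not depend on the chart selected at \<open>p\<close>.\<close>

definition tangent_map ::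
  "('m, 'e::euclidean_space) chart set \<Rightarrow> ('n, 'f::euclidean_space) chart set \<Rightarrow>
   ('m \<Rightarrow> 'n) \<Rightarrow> 'm \<Rightarrow> ('m, 'e) tvector \<Rightarrow> ('n, 'f) tvector" where
  "tangent_map A B f p v =
     (let c = (SOME c. c \<in> charts_at A p) in
      (\<lambda>d. if d \<in> charts_at B (f p)
           then frechet_derivative (coord d \<circ> f \<circ> cinv c) (at (coord c p)) (v c) else 0))"

definition vector_field ::
  "('m, 'e::euclidean_space) chart set \<Rightarrow> ('m \<Rightarrow> ('m, 'e) tvector) \<Rightarrow> bool" where
  "vector_field A X \<longleftrightarrow>
     (\<forall>p. X p \<in> tangent_space A p) \<and> (\<forall>c\<in>A. smooth_on (cimg c) (\<lambda>x. X (cinv c x) c))"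

section \<open>Tensor fields\<close>

text \<open>Tensor fields are \<open>0\<close> off the tangent spaces, so that their equality is equality of functions.\<close>

type_synonym ('m, 'e) oneform = "'m \<Rightarrow> ('m, 'e) tvector \<Rightarrow> real"
type_synonym ('m, 'e) tensor2 = "'m \<Rightarrow> ('m, 'e) tvector \<Rightarrow> ('m, 'e) tvector \<Rightarrow> real"

definition one_form :: "('m, 'e::euclidean_space) chart set \<Rightarrow> ('m, 'e) oneform \<Rightarrow> bool" where
  "one_form A \<omega> \<longleftrightarrow>
     (\<forall>p v. v \<notin> tangent_space A p \<longrightarrow> \<omega> p v = 0) \<and>
     (\<forall>p. \<forall>v\<in>tangent_space A p. \<forall>w\<in>tangent_space A p. \<forall>a b.
        \<omega> p (\<lambda>c. a *\<^sub>R v c + b *\<^sub>R w c) = a * \<omega> p v + b * \<omega> p w) \<and>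
     (\<forall>c\<in>A. \<forall>a. smooth_on (cimg c) (\<lambda>x. \<omega> (cinv c x) (coord_vector A c (cinv c x) a)))"

text \<open>The bilinear form representing \<open>g\<close> in the chart \<open>c\<close> at the coordinate point \<open>x\<close>:\<close>

definition components ::
  "('m, 'e::euclidean_space) chart set \<Rightarrow> ('m, 'e) tensor2 \<Rightarrow> ('m, 'e) chart \<Rightarrow>
   'e \<Rightarrow> 'e \<Rightarrow> 'e \<Rightarrow> real" where
  "components A g c x a b =
     g (cinv c x) (coord_vector A c (cinv c x) a) (coord_vector A c (cinv c x) b)"

definition sym_tensor2 :: "('m, 'e::euclidean_space) chart set \<Rightarrow> ('m, 'e) tensor2 \<Rightarrow> bool" where
  "sym_tensor2 A g \<longleftrightarrow>
     (\<forall>p v w. v \<notin> tangent_space A p \<or> w \<notin> tangent_space A p \<longrightarrow> g p v w = 0) \<and>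
     (\<forall>p. \<forall>v\<in>tangent_space A p. \<forall>w\<in>tangent_space A p. g p v w = g p w v) \<and>
     (\<forall>p. \<forall>u\<in>tangent_space A p. \<forall>v\<in>tangent_space A p. \<forall>w\<in>tangent_space A p. \<forall>a b.
        g p (\<lambda>c. a *\<^sub>R u c + b *\<^sub>R v c) w = a * g p u w + b * g p v w) \<and>
     (\<forall>c\<in>A. \<forall>a b. smooth_on (cimg c) (\<lambda>x. components A g c x a b))"

definition riemannian_metric :: "('m, 'e::euclidean_space) chart set \<Rightarrow> ('m, 'e) tensor2 \<Rightarrow> bool" where
  "riemannian_metric A g \<longleftrightarrow>
     sym_tensor2 A g \<and> (\<forall>p. \<forall>v\<in>tangent_space A p. v \<noteq> (\<lambda>_. 0) \<longrightarrow> g p v v > 0)"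

text \<open>The index of a symmetric bilinear form: the largest dimension of a negative definite subspace.\<close>

definition form_index :: "('e::euclidean_space \<Rightarrow> 'e \<Rightarrow> real) \<Rightarrow> nat" where
  "form_index B = Max {dim W | W. subspace W \<and> (\<forall>a\<in>W. a \<noteq> 0 \<longrightarrow> B a a < 0)}"

definition nondegenerate :: "('e::euclidean_space \<Rightarrow> 'e \<Rightarrow> real) \<Rightarrow> bool" where
  "nondegenerate B \<longleftrightarrow> (\<forall>a. (\<forall>b. B a b = 0) \<longrightarrow> a = 0)"

definition lorentzian_metric :: "('m, 'e::euclidean_space) chart set \<Rightarrow> ('m, 'e) tensor2 \<Rightarrow> bool" where
  "lorentzian_metric A g \<longleftrightarrow>
     DIM('e) \<ge> 2 \<and> sym_tensor2 A g \<and>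
     (\<forall>c\<in>A. \<forall>x\<in>cimg c. nondegenerate (components A g c x) \<and> form_index (components A g c x) = 1)"

text \<open>
  The Lie derivative of \<open>g\<close> along \<open>X\<close> in the chart \<open>c\<close>:
  \<open>(L\<^sub>X g)\<^sub>i\<^sub>j = X\<^sup>k \<partial>\<^sub>k g\<^sub>i\<^sub>j + g\<^sub>k\<^sub>j \<partial>\<^sub>i X\<^sup>k + g\<^sub>i\<^sub>k \<partial>\<^sub>j X\<^sup>k\<close>.
\<close>

definition lie_derivative ::
  "('m, 'e::euclidean_space) chart set \<Rightarrow> ('m \<Rightarrow> ('m, 'e) tvector) \<Rightarrow> ('m, 'e) tensor2 \<Rightarrow>
   ('m, 'e) chart \<Rightarrow> 'e \<Rightarrow> 'e \<Rightarrow> 'e \<Rightarrow> real" where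
  "lie_derivative A X g c x a b =
     frechet_derivative (\<lambda>y. components A g c y a b) (at x) (X (cinv c x) c) +
     components A g c x (frechet_derivative (\<lambda>y. X (cinv c y) c) (at x) a) b +
     components A g c x a (frechet_derivative (\<lambda>y. X (cinv c y) c) (at x) b)"

definition killing_field ::
  "('m, 'e::euclidean_space) chart set \<Rightarrow> ('m, 'e) tensor2 \<Rightarrow> ('m \<Rightarrow> ('m, 'e) tvector) \<Rightarrow> bool" where
  "killing_field A g X \<longleftrightarrow>
     vector_field A X \<and> (\<forall>c\<in>A. \<forall>x\<in>cimg c. \<forall>a b. lie_derivative A X g c x a b = 0)"

definition conformal_map ::
  "('m::topological_space, 'e::euclidean_space) chart set \<Rightarrow> ('m, 'e) tensor2 \<Rightarrow> ('m \<Rightarrow> 'm) \<Rightarrow> bool"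
where
  "conformal_map A g \<psi> \<longleftrightarrow> diffeomorphism A \<psi> \<and>
     (\<exists>\<mu>::'m \<Rightarrow> real. (\<forall>p. \<mu> p > 0) \<and>
        (\<forall>p. \<forall>v\<in>tangent_space A p. \<forall>w\<in>tangent_space A p.
           g (\<psi> p) (tangent_map A A \<psi> p v) (tangent_map A A \<psi> p w) = \<mu> p * g p v w))"

definition preserves_field ::
  "('m, 'e::euclidean_space) chart set \<Rightarrow> ('m \<Rightarrow> ('m, 'e) tvector) \<Rightarrow> ('m \<Rightarrow> 'm) \<Rightarrow> bool" where
  "preserves_field A X \<psi> \<longleftrightarrow> (\<forall>p. tangent_map A A \<psi> p (X p) = X (\<psi> p))"

definition orthogonal_space ::
  "('m, 'e::euclidean_space) chart set \<Rightarrow> ('m, 'e) tensor2 \<Rightarrow> ('m \<Rightarrow> ('m, 'e) tvector) \<Rightarrow>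
   'm \<Rightarrow> ('m, 'e) tvector set" where
  "orthogonal_space A g X p = {v \<in> tangent_space A p. g p v (X p) = 0}"

section \<open>The product of the real line with a manifold\<close>

abbreviation RS :: "('s, 'e) chart set \<Rightarrow> (real \<times> 's, real \<times> 'e) chart set" where
  "RS A \<equiv> prod_atlas line_atlas A"

text \<open>The field \<open>\<partial>\<^sub>t\<close>, as the velocity of the lines \<open>t \<mapsto> (t, x)\<close>:\<close>

definition K_field ::
  "('s, 'e::euclidean_space) chart set \<Rightarrow> real \<times> 's \<Rightarrow> (real \<times> 's, real \<times> 'e) tvector" where
  "K_field A p =
     (\<lambda>d. if d \<in> charts_at (RS A) p
          then vector_derivative (\<lambda>t. coord d (t, snd p)) (at (fst p)) else 0)"

definition dt_form :: "('s, 'e::euclidean_space) chart set \<Rightarrow> (real \<times> 's, real \<times> 'e) oneform" where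
  "dt_form A p w = tangent_map (RS A) line_atlas fst p w (UNIV, \<lambda>t. t)"

definition space_part ::
  "('s, 'e::euclidean_space) chart set \<Rightarrow> real \<times> 's \<Rightarrow> (real \<times> 's, real \<times> 'e) tvector \<Rightarrow>
   ('s, 'e) tvector" where
  "space_part A p w = tangent_map (RS A) A snd p w"

definition SOM :: "('s, 'e::euclidean_space) chart set \<Rightarrow> (real \<times> 's, real \<times> 'e) tensor2 set" where
  "SOM A = {g. lorentzian_metric (RS A) g \<and>
     (\<exists>\<beta> \<omega> g\<^sub>0. smooth_fun A \<beta> \<and> (\<forall>x. \<beta> x > 0) \<and> one_form A \<omega> \<and> sym_tensor2 A g\<^sub>0 \<and>
        (\<forall>x. \<forall>v\<in>tangent_space A x. v \<noteq> (\<lambda>_. 0) \<longrightarrow> g\<^sub>0 x v v + 1 / \<beta> x * (\<omega> x v)\<^sup>2 > 0) \<and>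
        (\<forall>t x. \<forall>w\<in>tangent_space (RS A) (t, x). \<forall>w'\<in>tangent_space (RS A) (t, x).
           g (t, x) w w' =
             - \<beta> x * dt_form A (t, x) w * dt_form A (t, x) w'
             + dt_form A (t, x) w * \<omega> x (space_part A (t, x) w')
             + \<omega> x (space_part A (t, x) w) * dt_form A (t, x) w'
             + g\<^sub>0 x (space_part A (t, x) w) (space_part A (t, x) w')))}"

definition Stat\<^sub>R :: "('s, 'e::euclidean_space) chart set \<Rightarrow> (real \<times> 's, real \<times> 'e) tensor2 set" where
  "Stat\<^sub>R A = {g. riemannian_metric (RS A) g \<and> killing_field (RS A) g (K_field A)}"

text \<open>
  The symmetric bilinear form associated by polarization with the quadratic form
  \<open>w \<mapsto> g(w,w) - 2 g(w,K)\<^sup>2 / g(K,K)\<close>.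
\<close>

definition Psi ::
  "('s, 'e::euclidean_space) chart set \<Rightarrow> (real \<times> 's, real \<times> 'e) tensor2 \<Rightarrow>
   (real \<times> 's, real \<times> 'e) tensor2" where
  "Psi A g = (\<lambda>p v w. g p v w - 2 * (g p v (K_field A p) * g p w (K_field A p)) /
                                  g p (K_field A p) (K_field A p))"

end

theory Submission
  imports Defs
begin

text \<open>
  At each point the correspondence is the reflection of a symmetric bilinear form in the line spanned
  by \<open>K\<close>: it changes the sign of \<open>g\<close> on that line and keeps \<open>g\<close> on the orthogonal complement. Hence
  it is an involution wherever \<open>g(K, K)\<close> does not vanish (\<open>Psi_involution\<close>), it keeps the orthogonal
  complement of \<open>K\<close>, and, being built from \<open>g\<close> and \<open>K\<close> by an expression that is homogeneous of
  degree one in \<open>g\<close>, it is compatible with conformal maps that preserve \<open>K\<close>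
  (\<open>Psi_conformal_map\<close>). It remains to see that it exchanges the two classes of metrics.

  Everything else is read in the charts \<open>\<real> \<times> c\<close> over charts \<open>c\<close> of \<open>S\<close>. There \<open>K\<close> is the constant
  vector \<open>(1, 0)\<close>, so \<open>K\<close> is a Killing field exactly if the components of the metric do not depend on
  \<open>t\<close> (\<open>killing_field_iff_time_independent\<close>), a property that the reflection respects, and the
  components of the reflected metric are smooth because they are rational in those of the original
  one (\<open>sym_tensor2_Psi\<close>).

  From Lorentzian to Riemannian, positivity comes from completing the square in the standard form
  (\<open>SOM_Psi_positive\<close>). In the other direction, the reflection of a positive definite form is
  nondegenerate of index one (\<open>nondegenerate_reflected_form\<close>, \<open>form_index_reflected_form\<close>), and
  independence of time lets the coefficients \<open>\<beta>\<close>, \<open>\<omega>\<close> and \<open>g\<^sub>0\<close> be read off at time \<open>0\<close>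
  (\<open>time_independent_expansion\<close>); the positivity condition on them is the strict Cauchy-Schwarz
  inequality (\<open>Stat_Psi_in_SOM\<close>).
\<close>

section \<open>Calculus of smooth functions\<close>

lemma has_derivative_cong_open:
  assumes "open U" "x \<in> U" "\<And>y. y \<in> U \<Longrightarrow> f y = g y"
  shows "(f has_derivative D) (at x) \<longleftrightarrow> (g has_derivative D) (at x)"
  using assms has_derivative_transform_within_open[of f D x UNIV U g]
    has_derivative_transform_within_open[of g D x UNIV U f] by auto

lemma frechet_derivative_cong_open:
  assumes "open U" "x \<in> U" "\<And>y. y \<in> U \<Longrightarrow> f y = g y"
  shows "frechet_derivative f (at x) = frechet_derivative g (at x)"
  unfolding frechet_derivative_def using has_derivative_cong_open[OF assms] by simp

text \<open>
  Openness is essential: it makes functions that agree on the set have the same derivatives there, so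
  that agreement is inherited by all iterated derivatives.
\<close>

lemma Ck_on_cong:
  assumes "open U" "\<And>x. x \<in> U \<Longrightarrow> f x = g x" "Ck_on k U f"
  shows "Ck_on k U g"
  using assms(2,3)
proof (induction k arbitrary: f g)
  case 0
  then show ?case using continuous_on_cong[of U U f g] by simp
next
  case (Suc k)
  have "g differentiable (at x)" if "x \<in> U" for x
    using Suc.prems has_derivative_cong_open[OF assms(1) that, of f g] that
    unfolding differentiable_def Ck_on.simps by metis
  moreover have "Ck_on k U (\<lambda>x. frechet_derivative g (at x) v)" for v
    by (rule Suc.IH[of "\<lambda>x. frechet_derivative f (at x) v"])
      (use Suc.prems frechet_derivative_cong_open[OF assms(1), of _ f g] in auto)
  ultimately show ?case by simp
qed

text \<open>
  The recursion behind \<^const>\<open>Ck_on\<close> refers to \<^const>\<open>frechet_derivative\<close>; this rule lets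
  the derivative be supplied by a closed formula, such as the product rule, in all closure properties
  that follow.
\<close>

lemma Ck_on_SucI:
  assumes "open U" "\<And>x. x \<in> U \<Longrightarrow> (f has_derivative D x) (at x)"
    and "\<And>v. Ck_on k U (\<lambda>x. D x v)"
  shows "Ck_on (Suc k) U f"
proof -
  have "Ck_on k U (\<lambda>x. frechet_derivative f (at x) v)" for v
    by (rule Ck_on_cong[OF assms(1) _ assms(3)[of v]]) (metis assms(2) frechet_derivative_at)
  then show ?thesis using assms(2) by (auto simp: differentiable_def)
qed

lemma Ck_on_SucD:
  assumes "Ck_on (Suc k) U f"
  shows "x \<in> U \<Longrightarrow> (f has_derivative frechet_derivative f (at x)) (at x)"
    and "Ck_on k U (\<lambda>x. frechet_derivative f (at x) v)"
  using assms by (auto simp: frechet_derivative_works)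

lemma Ck_on_Suc_imp_Ck_on: "Ck_on (Suc k) U f \<Longrightarrow> Ck_on k U f"
proof (induction k arbitrary: f)
  case 0
  then show ?case
    by (auto intro!: continuous_at_imp_continuous_on differentiable_imp_continuous_within)
next
  case (Suc k)
  then show ?case using Ck_on.simps(2) by blast
qed

lemma Ck_on_const: "Ck_on k U (\<lambda>_. c)"
  by (induction k arbitrary: c) auto

lemma Ck_on_linear:
  fixes L :: "'a::euclidean_space \<Rightarrow> 'b::euclidean_space"
  assumes "open U" "linear L"
  shows "Ck_on k U L"
proof (cases k)
  case 0
  then show ?thesis using assms(2) by (simp add: linear_continuous_on linear_linear)
next
  case (Suc m)
  have "Ck_on (Suc m) U L"
    by (rule Ck_on_SucI[OF assms(1), of _ "\<lambda>_. L"])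
      (use assms(2) in \<open>auto simp: linear_imp_has_derivative Ck_on_const\<close>)
  then show ?thesis using Suc by simp
qed

lemma Ck_on_add:
  assumes "open U" "Ck_on k U f" "Ck_on k U g"
  shows "Ck_on k U (\<lambda>x. f x + g x)"
  using assms(2,3)
proof (induction k arbitrary: f g)
  case 0
  then show ?case by (auto intro: continuous_on_add)
next
  case (Suc k)
  show ?case
    by (rule Ck_on_SucI[OF assms(1) has_derivative_add[OF
          Ck_on_SucD(1)[OF Suc.prems(1)] Ck_on_SucD(1)[OF Suc.prems(2)]]])
      (use Suc Ck_on_SucD(2) in auto)
qed

lemma Ck_on_Pair:
  assumes "open U" "Ck_on k U f" "Ck_on k U g"
  shows "Ck_on k U (\<lambda>x. (f x, g x))"
  using assms(2,3)
proof (induction k arbitrary: f g)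
  case 0
  then show ?case by (auto intro: continuous_on_Pair)
next
  case (Suc k)
  show ?case
    by (rule Ck_on_SucI[OF assms(1) has_derivative_Pair[OF
          Ck_on_SucD(1)[OF Suc.prems(1)] Ck_on_SucD(1)[OF Suc.prems(2)]]])
      (use Suc Ck_on_SucD(2) in auto)
qed

lemma Ck_on_mult:
  fixes f g :: "'a::euclidean_space \<Rightarrow> real"
  assumes "open U" "Ck_on k U f" "Ck_on k U g"
  shows "Ck_on k U (\<lambda>x. f x * g x)"
  using assms(2,3)
proof (induction k arbitrary: f g)
  case 0
  then show ?case by (auto intro: continuous_on_mult)
next
  case (Suc k)
  have lower: "Ck_on k U f" "Ck_on k U g"
    using Suc.prems Ck_on_Suc_imp_Ck_on by blast+
  show ?case
    by (rule Ck_on_SucI[OF assms(1) has_derivative_mult[OF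
          Ck_on_SucD(1)[OF Suc.prems(1)] Ck_on_SucD(1)[OF Suc.prems(2)]]], assumption, assumption)
      (intro Ck_on_add[OF assms(1)] Suc.IH lower Ck_on_SucD(2)[OF Suc.prems(1)]
        Ck_on_SucD(2)[OF Suc.prems(2)])
qed

text \<open>
  Differentiating \<open>1 / f\<close> gives \<open>- f' / f\<^sup>2\<close>, in which \<open>1 / f\<close> reappears with one order of
  differentiability less to be shown; hence the induction closes.
\<close>

lemma Ck_on_inverse:
  fixes f :: "'a::euclidean_space \<Rightarrow> real"
  assumes "open U" "Ck_on k U f" "\<And>x. x \<in> U \<Longrightarrow> f x \<noteq> 0"
  shows "Ck_on k U (\<lambda>x. inverse (f x))"
  using assms(2)
proof (induction k)
  case 0
  then show ?case using assms(3) by (auto intro: continuous_on_inverse)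
next
  case (Suc k)
  have inv: "Ck_on k U (\<lambda>x. inverse (f x))"
    using Suc Ck_on_Suc_imp_Ck_on by blast
  have "Ck_on k U (\<lambda>x. - 1 * (inverse (f x) * frechet_derivative f (at x) v * inverse (f x)))" for v
    by (intro Ck_on_mult[OF assms(1)] Ck_on_const inv Ck_on_SucD(2)[OF Suc.prems])
  then show ?case
    by (intro Ck_on_SucI[OF assms(1) Deriv.has_derivative_inverse[OF assms(3) Ck_on_SucD(1)[OF Suc.prems]]])
      (auto simp del: Ck_on.simps)
qed

text \<open>
  Only linear inner functions occur below: the projection from space-time to space and the inclusion
  of the time slice \<open>t = 0\<close>. For these the derivative of the composite is again a directional
  derivative of \<open>f\<close>, composed with the same linear map, so that the induction closes.
\<close>

lemma Ck_on_compose_linear: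
  fixes L :: "'a::euclidean_space \<Rightarrow> 'b::euclidean_space"
  assumes "linear L" "open V" "\<And>x. x \<in> V \<Longrightarrow> L x \<in> U" "Ck_on k U f"
  shows "Ck_on k V (\<lambda>x. f (L x))"
  using assms(4)
proof (induction k arbitrary: f)
  case 0
  then show ?case
    using continuous_on_compose2[of U f V L] assms(1,3)
    by (auto simp: linear_continuous_on linear_linear)
next
  case (Suc k)
  have "((\<lambda>x. f (L x)) has_derivative (\<lambda>v. frechet_derivative f (at (L x)) (L v))) (at x)"
    if "x \<in> V" for x
    using has_derivative_compose[OF linear_imp_has_derivative[OF assms(1)]
        Ck_on_SucD(1)[OF Suc.prems assms(3)[OF that]]] .
  then show ?case
    by (rule Ck_on_SucI[OF assms(2)]) (use Suc.IH Ck_on_SucD(2)[OF Suc.prems] in blast)+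
qed

lemma smooth_on_cong:
  "open U \<Longrightarrow> (\<And>x. x \<in> U \<Longrightarrow> f x = g x) \<Longrightarrow> smooth_on U f \<Longrightarrow> smooth_on U g"
  unfolding smooth_on_def by (metis Ck_on_cong)

lemma smooth_on_differentiable: "smooth_on U f \<Longrightarrow> x \<in> U \<Longrightarrow> f differentiable (at x)"
  unfolding smooth_on_def by (metis Ck_on.simps(2))

lemma smooth_on_const: "smooth_on U (\<lambda>_. c)"
  by (simp add: smooth_on_def Ck_on_const)

lemma smooth_on_compose_linear:
  "linear L \<Longrightarrow> open V \<Longrightarrow> (\<And>x. x \<in> V \<Longrightarrow> L x \<in> U) \<Longrightarrow> smooth_on U f \<Longrightarrow>
    smooth_on V (\<lambda>x. f (L x))"
  unfolding smooth_on_def using Ck_on_compose_linear by blast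

lemma smooth_on_mult:
  fixes f g :: "'a::euclidean_space \<Rightarrow> real"
  shows "open U \<Longrightarrow> smooth_on U f \<Longrightarrow> smooth_on U g \<Longrightarrow> smooth_on U (\<lambda>x. f x * g x)"
  by (simp add: smooth_on_def Ck_on_mult)

section \<open>Charts and tangent vectors\<close>

lemma coord_in_cimg: "p \<in> cdom c \<Longrightarrow> coord c p \<in> cimg c"
  by (simp add: cimg_def)

context
  fixes A :: "('m::topological_space, 'e::euclidean_space) chart set"
  assumes A: "smooth_atlas A"
begin

lemma chart_open_domain: "c \<in> A \<Longrightarrow> open (cdom c)"
  and chart_open_image: "c \<in> A \<Longrightarrow> open (cimg c)"
  and chart_homeomorphism: "c \<in> A \<Longrightarrow> homeomorphism (cdom c) (cimg c) (coord c) (cinv c)"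
  using A by (auto simp: smooth_atlas_def is_chart_def)

lemma cinv_coord: "c \<in> A \<Longrightarrow> p \<in> cdom c \<Longrightarrow> cinv c (coord c p) = p"
  using chart_homeomorphism by (auto simp: homeomorphism_def)

lemma coord_cinv: "c \<in> A \<Longrightarrow> x \<in> cimg c \<Longrightarrow> coord c (cinv c x) = x"
  using chart_homeomorphism by (auto simp: homeomorphism_def)

lemma cinv_in_cdom: "c \<in> A \<Longrightarrow> x \<in> cimg c \<Longrightarrow> cinv c x \<in> cdom c"
  using chart_homeomorphism by (fastforce simp: homeomorphism_def)

lemma cinv_charts_at: "c \<in> A \<Longrightarrow> x \<in> cimg c \<Longrightarrow> c \<in> charts_at A (cinv c x)"
  by (simp add: charts_at_def cinv_in_cdom)

lemma exists_chart_at: "\<exists>c. c \<in> charts_at A p"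
proof -
  have "p \<in> (\<Union>c\<in>A. cdom c)" using A by (simp add: smooth_atlas_def)
  then show ?thesis by (auto simp: charts_at_def)
qed

lemma overlap_open:
  assumes "c \<in> A" "d \<in> A"
  shows "open (coord c ` (cdom c \<inter> cdom d))"
proof -
  have "openin (top_of_set (cimg c)) (coord c ` (cdom c \<inter> cdom d))"
    using homeomorphism_imp_open_map[OF chart_homeomorphism[OF assms(1)]]
      chart_open_domain[OF assms(2)] openin_open by blast
  then show ?thesis using chart_open_image[OF assms(1)] openin_open_trans by blast
qed

lemma transition_has_derivative:
  assumes "c \<in> charts_at A p" "d \<in> charts_at A p"
  shows "((coord d \<circ> cinv c) has_derivative frechet_derivative (coord d \<circ> cinv c) (at (coord c p)))
    (at (coord c p))"
proof -
  have "smooth_on (coord c ` (cdom c \<inter> cdom d)) (coord d \<circ> cinv c)"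
    using A assms by (auto simp: smooth_atlas_def charts_at_def)
  then have "(coord d \<circ> cinv c) differentiable (at (coord c p))"
    by (rule smooth_on_differentiable) (use assms in \<open>auto simp: charts_at_def\<close>)
  then show ?thesis by (simp add: frechet_derivative_works)
qed

lemma transition_derivative_linear:
  assumes "c \<in> charts_at A p" "d \<in> charts_at A p"
  shows "linear (frechet_derivative (coord d \<circ> cinv c) (at (coord c p)))"
  using transition_has_derivative[OF assms] has_derivative_linear by blast

lemma transition_derivative_self:
  assumes "c \<in> charts_at A p"
  shows "frechet_derivative (coord c \<circ> cinv c) (at (coord c p)) = (\<lambda>a. a)"
proof -
  have "frechet_derivative (coord c \<circ> cinv c) (at (coord c p)) = frechet_derivative (\<lambda>x. x) (at (coord c p))"
    by (rule frechet_derivative_cong_open[of "cimg c"])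
      (use assms in \<open>auto simp: charts_at_def chart_open_image coord_in_cimg coord_cinv\<close>)
  then show ?thesis by simp
qed

text \<open>
  The chain rule for \<open>e \<circ> d\<^sup>-\<^sup>1 \<circ> d \<circ> c\<^sup>-\<^sup>1\<close>, which agrees with \<open>e \<circ> c\<^sup>-\<^sup>1\<close> near the point. All facts
  about tangent vectors as families of components rest on it.
\<close>

lemma transition_derivative_cocycle:
  assumes "c \<in> charts_at A p" "d \<in> charts_at A p" "e \<in> charts_at A p"
  shows "frechet_derivative (coord e \<circ> cinv d) (at (coord d p))
      (frechet_derivative (coord d \<circ> cinv c) (at (coord c p)) a) =
    frechet_derivative (coord e \<circ> cinv c) (at (coord c p)) a"
proof -
  let ?U = "coord c ` (cdom c \<inter> cdom d)"
  have cd: "c \<in> A" "d \<in> A" "p \<in> cdom c" "p \<in> cdom d" using assms by (auto simp: charts_at_def)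
  have p: "coord d p = (coord d \<circ> cinv c) (coord c p)" using cd by (simp add: cinv_coord)
  have "((coord e \<circ> cinv d) \<circ> (coord d \<circ> cinv c) has_derivative
      frechet_derivative (coord e \<circ> cinv d) (at (coord d p)) \<circ>
      frechet_derivative (coord d \<circ> cinv c) (at (coord c p))) (at (coord c p))"
    by (rule diff_chain_at[OF transition_has_derivative[OF assms(1,2)]])
      (use transition_has_derivative[OF assms(2,3)] p in simp)
  then have "frechet_derivative ((coord e \<circ> cinv d) \<circ> (coord d \<circ> cinv c)) (at (coord c p)) =
      frechet_derivative (coord e \<circ> cinv d) (at (coord d p)) \<circ>
      frechet_derivative (coord d \<circ> cinv c) (at (coord c p))"
    by (metis frechet_derivative_at)
  moreover have "frechet_derivative ((coord e \<circ> cinv d) \<circ> (coord d \<circ> cinv c)) (at (coord c p)) =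
      frechet_derivative (coord e \<circ> cinv c) (at (coord c p))"
    by (rule frechet_derivative_cong_open[OF overlap_open[OF cd(1,2)]])
      (use cd in \<open>auto simp: cinv_coord\<close>)
  ultimately show ?thesis by (metis comp_apply)
qed

lemma coord_vector_in_tangent_space:
  assumes "c \<in> charts_at A p"
  shows "coord_vector A c p a \<in> tangent_space A p"
proof -
  have "coord_vector A c p a e =
      frechet_derivative (coord e \<circ> cinv d) (at (coord d p)) (coord_vector A c p a d)"
    if "d \<in> charts_at A p" "e \<in> charts_at A p" for d e
    unfolding coord_vector_def
    by (simp only: that if_True transition_derivative_cocycle[OF assms that, symmetric])
  moreover have "coord_vector A c p a d = 0" if "d \<notin> charts_at A p" for d
    using that by (simp add: coord_vector_def)
  ultimately show ?thesis unfolding tangent_space_def by blast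
qed

lemma coord_vector_component: "c \<in> charts_at A p \<Longrightarrow> coord_vector A c p a c = a"
  by (simp add: coord_vector_def transition_derivative_self)

text \<open>
  Together with the two preceding facts: for a fixed chart at \<open>p\<close>, taking components identifies the
  tangent space at \<open>p\<close> with the model space.
\<close>

lemma coord_vector_of_component:
  assumes "c \<in> charts_at A p" "v \<in> tangent_space A p"
  shows "coord_vector A c p (v c) = v"
proof
  fix d
  show "coord_vector A c p (v c) d = v d"
    using assms unfolding tangent_space_def coord_vector_def mem_Collect_eq by metis
qed

lemma tangent_vector_eqI:
  assumes "c \<in> charts_at A p" "v \<in> tangent_space A p" "w \<in> tangent_space A p" "v c = w c"
  shows "v = w"
  using assms coord_vector_of_component by metis

lemma coord_vector_combination:
  assumes "c \<in> charts_at A p"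
  shows "coord_vector A c p (r *\<^sub>R a + s *\<^sub>R b) =
    (\<lambda>d. r *\<^sub>R coord_vector A c p a d + s *\<^sub>R coord_vector A c p b d)"
proof
  fix d
  show "coord_vector A c p (r *\<^sub>R a + s *\<^sub>R b) d =
      r *\<^sub>R coord_vector A c p a d + s *\<^sub>R coord_vector A c p b d"
  proof (cases "d \<in> charts_at A p")
    case True
    show ?thesis
      unfolding coord_vector_def
      using True linear_add[OF transition_derivative_linear[OF assms True]]
        linear_scale[OF transition_derivative_linear[OF assms True]] by simp
  qed (simp add: coord_vector_def)
qed

lemma tangent_space_combination:
  assumes "v \<in> tangent_space A p" "w \<in> tangent_space A p"
  shows "(\<lambda>c. r *\<^sub>R v c + s *\<^sub>R w c) \<in> tangent_space A p"
proof -
  obtain c where c: "c \<in> charts_at A p" using exists_chart_at by blast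
  have "(\<lambda>d. r *\<^sub>R v d + s *\<^sub>R w d) = coord_vector A c p (r *\<^sub>R v c + s *\<^sub>R w c)"
    by (simp only: coord_vector_combination[OF c] coord_vector_of_component[OF c assms(1)]
        coord_vector_of_component[OF c assms(2)])
  then show ?thesis using coord_vector_in_tangent_space[OF c] by metis
qed

lemma tangent_space_zero: "(\<lambda>_. 0) \<in> tangent_space A p"
proof -
  obtain c where c: "c \<in> charts_at A p" using exists_chart_at by blast
  show ?thesis
    using tangent_space_combination[OF coord_vector_in_tangent_space[OF c]
        coord_vector_in_tangent_space[OF c], of 0 _ 0] by simp
qed

lemma components_coord:
  assumes "c \<in> charts_at A p" "v \<in> tangent_space A p" "w \<in> tangent_space A p"
  shows "components A g c (coord c p) (v c) (w c) = g p v w"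
proof -
  have "cinv c (coord c p) = p" using assms(1) by (simp add: charts_at_def cinv_coord)
  then show ?thesis
    by (simp only: components_def coord_vector_of_component[OF assms(1,2)]
        coord_vector_of_component[OF assms(1,3)])
qed

end

section \<open>The product with the real line\<close>

text \<open>
  The charts of the product are exactly the cylinders over the charts of \<open>S\<close>. Naming them lets every
  computation on \<open>\<real> \<times> S\<close> be carried out in coordinates \<open>(t, x)\<close>.
\<close>

definition cylinder_chart :: "('s, 'e) chart \<Rightarrow> (real \<times> 's, real \<times> 'e) chart" where
  "cylinder_chart c = (UNIV \<times> cdom c, map_prod (\<lambda>t. t) (coord c))"

lemma cdom_cylinder_chart: "cdom (cylinder_chart c) = UNIV \<times> cdom c"
  and coord_cylinder_chart: "coord (cylinder_chart c) p = (fst p, coord c (snd p))"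
  by (simp_all add: cylinder_chart_def cdom_def coord_def map_prod_def split_beta)

lemma cimg_cylinder_chart: "cimg (cylinder_chart c) = UNIV \<times> cimg c"
  by (force simp: cimg_def cdom_cylinder_chart coord_cylinder_chart)

lemma RS_eq_cylinder_charts: "RS A = cylinder_chart ` A"
proof -
  have "cdom (UNIV, \<lambda>t::real. t) = UNIV" "coord (UNIV, \<lambda>t::real. t) = (\<lambda>t. t)"
    by (simp_all add: cdom_def coord_def)
  then show ?thesis
    by (auto simp: prod_atlas_def line_atlas_def cylinder_chart_def)
qed

lemma charts_at_RS: "charts_at (RS A) p = cylinder_chart ` charts_at A (snd p)"
  by (cases p) (auto simp: charts_at_def RS_eq_cylinder_charts cdom_cylinder_chart)

lemma cylinder_chart_at: "c \<in> charts_at A (snd p) \<Longrightarrow> cylinder_chart c \<in> charts_at (RS A) p"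
  by (simp add: charts_at_RS)

text \<open>
  For a tangent vector \<open>v\<close> of \<open>S\<close> the result does not depend on the selected chart
  (\<open>horizontal_lift_eq_coord_vector\<close>). Lifts serve to read off the forms \<open>\<omega>\<close> and \<open>g\<^sub>0\<close> from a metric on the product.
\<close>

definition horizontal_lift ::
  "('s, 'e::euclidean_space) chart set \<Rightarrow> real \<times> 's \<Rightarrow> ('s, 'e) tvector \<Rightarrow>
   (real \<times> 's, real \<times> 'e) tvector" where
  "horizontal_lift A p v =
    (let c = (SOME c. c \<in> charts_at A (snd p)) in coord_vector (RS A) (cylinder_chart c) p (0, v c))"

context
  fixes A :: "('s::topological_space, 'e::euclidean_space) chart set"
  assumes A: "smooth_atlas A"
begin

lemma cinv_cylinder_chart:
  assumes "c \<in> A" "snd z \<in> cimg c"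
  shows "cinv (cylinder_chart c) z = (fst z, cinv c (snd z))"
  unfolding cinv_def[of "cylinder_chart c"]
proof (rule inv_into_f_eq)
  show "inj_on (coord (cylinder_chart c)) (cdom (cylinder_chart c))"
    using cinv_coord[OF A assms(1)]
    by (force simp: inj_on_def cdom_cylinder_chart coord_cylinder_chart dest: arg_cong[of _ _ "cinv c"])
qed (use assms in \<open>auto simp: cdom_cylinder_chart coord_cylinder_chart cinv_in_cdom[OF A] coord_cinv[OF A]\<close>)

lemma homeomorphism_cylinder_chart:
  assumes "c \<in> A"
  shows "homeomorphism (cdom (cylinder_chart c)) (cimg (cylinder_chart c))
    (coord (cylinder_chart c)) (cinv (cylinder_chart c))"
proof (rule homeomorphismI)
  note hom = chart_homeomorphism[OF A assms]
  have "continuous_on (UNIV \<times> cdom c) (\<lambda>p::real \<times> 's. (fst p, coord c (snd p)))"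
    by (intro continuous_intros continuous_on_compose2[OF homeomorphism_cont1[OF hom]]) auto
  then show "continuous_on (cdom (cylinder_chart c)) (coord (cylinder_chart c))"
    by (simp add: cdom_cylinder_chart coord_cylinder_chart[abs_def])
  have "continuous_on (UNIV \<times> cimg c) (\<lambda>z::real \<times> 'e. (fst z, cinv c (snd z)))"
    by (intro continuous_intros continuous_on_compose2[OF homeomorphism_cont2[OF hom]]) auto
  then show "continuous_on (cimg (cylinder_chart c)) (cinv (cylinder_chart c))"
    by (rule continuous_on_cong[THEN iffD1, rotated 2]) (auto simp: cimg_cylinder_chart cinv_cylinder_chart[OF assms])
  show "coord (cylinder_chart c) ` cdom (cylinder_chart c) \<subseteq> cimg (cylinder_chart c)"
    by (simp add: cimg_def)
  show "cinv (cylinder_chart c) ` cimg (cylinder_chart c) \<subseteq> cdom (cylinder_chart c)"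
    by (auto simp: cimg_cylinder_chart cdom_cylinder_chart cinv_cylinder_chart[OF assms]
        cinv_in_cdom[OF A assms])
qed (auto simp: cimg_cylinder_chart cdom_cylinder_chart cinv_cylinder_chart[OF assms]
    coord_cylinder_chart cinv_coord[OF A assms] coord_cinv[OF A assms] coord_in_cimg)

lemma cylinder_transition:
  assumes "c \<in> A" "z \<in> coord (cylinder_chart c) ` (cdom (cylinder_chart c) \<inter> cdom (cylinder_chart d))"
  shows "(coord (cylinder_chart d) \<circ> cinv (cylinder_chart c)) z = (fst z, (coord d \<circ> cinv c) (snd z))"
proof -
  have "snd z \<in> cimg c"
    using assms(2) by (auto simp: cdom_cylinder_chart coord_cylinder_chart coord_in_cimg)
  then show ?thesis by (simp add: coord_cylinder_chart cinv_cylinder_chart[OF assms(1)])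
qed

lemma smooth_atlas_RS: "smooth_atlas (RS A)"
  unfolding smooth_atlas_def RS_eq_cylinder_charts ball_simps
proof (intro conjI ballI)
  fix c assume c: "c \<in> A"
  show "is_chart (cylinder_chart c)"
    unfolding is_chart_def using homeomorphism_cylinder_chart[OF c]
    by (simp add: cdom_cylinder_chart cimg_cylinder_chart open_Times chart_open_domain[OF A c]
        chart_open_image[OF A c])
next
  show "(\<Union>c\<in>cylinder_chart ` A. cdom c) = UNIV"
    using exists_chart_at[OF A] by (auto simp: cdom_cylinder_chart charts_at_def)
next
  fix c d assume cd: "c \<in> A" "d \<in> A"
  let ?V = "coord c ` (cdom c \<inter> cdom d)"
  let ?U = "coord (cylinder_chart c) ` (cdom (cylinder_chart c) \<inter> cdom (cylinder_chart d))"
  have U: "?U = UNIV \<times> ?V"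
    by (force simp: cdom_cylinder_chart coord_cylinder_chart)
  have oU: "open ?U"
    unfolding U by (intro open_Times open_UNIV overlap_open[OF A cd])
  have "smooth_on ?V (coord d \<circ> cinv c)"
    using A cd by (simp add: smooth_atlas_def)
  then have "Ck_on k ?U (\<lambda>z. (fst z, (coord d \<circ> cinv c) (snd z)))" for k
    unfolding smooth_on_def
    by (intro Ck_on_Pair[OF oU] Ck_on_linear[OF oU linear_fst]
        Ck_on_compose_linear[OF linear_snd oU, of ?V]) (simp_all only: U mem_Times_iff)
  then have "smooth_on ?U (\<lambda>z. (fst z, (coord d \<circ> cinv c) (snd z)))"
    by (simp add: smooth_on_def)
  then show "smooth_on ?U (coord (cylinder_chart d) \<circ> cinv (cylinder_chart c))"
    by (rule smooth_on_cong[OF oU, rotated]) (simp only: cylinder_transition[OF cd(1)])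
qed

text \<open>
  Coordinate changes between cylinders fix the time coordinate, so their derivatives are block
  diagonal. This is why \<open>\<partial>\<^sub>t\<close> has the same components in every cylinder, and why time and space
  components of a tangent vector can be separated independently of the chart.
\<close>

lemma cylinder_transition_derivative:
  assumes "c \<in> charts_at A (snd p)" "d \<in> charts_at A (snd p)"
  shows "frechet_derivative (coord (cylinder_chart d) \<circ> cinv (cylinder_chart c))
      (at (coord (cylinder_chart c) p)) a =
    (fst a, frechet_derivative (coord d \<circ> cinv c) (at (coord c (snd p))) (snd a))"
proof -
  let ?D = "frechet_derivative (coord d \<circ> cinv c) (at (coord c (snd p)))"
  let ?z = "coord (cylinder_chart c) p"
  let ?U = "coord (cylinder_chart c) ` (cdom (cylinder_chart c) \<inter> cdom (cylinder_chart d))"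
  have cd: "c \<in> A" "d \<in> A" "snd p \<in> cdom c" "snd p \<in> cdom d"
    using assms by (auto simp: charts_at_def)
  have oU: "open ?U"
    using overlap_open[OF smooth_atlas_RS] cd by (simp add: RS_eq_cylinder_charts)
  have z: "?z \<in> ?U"
    using cd by (cases p) (auto simp: cdom_cylinder_chart)
  have "((coord d \<circ> cinv c) has_derivative ?D) (at (snd ?z))"
    using transition_has_derivative[OF A assms] by (simp add: coord_cylinder_chart)
  from has_derivative_compose[OF has_derivative_snd[OF has_derivative_ident] this]
  have "((\<lambda>z. (fst z, (coord d \<circ> cinv c) (snd z))) has_derivative (\<lambda>a. (fst a, ?D (snd a)))) (at ?z)"
    by (intro has_derivative_Pair has_derivative_fst has_derivative_ident) simp
  then have "((coord (cylinder_chart d) \<circ> cinv (cylinder_chart c)) has_derivative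
      (\<lambda>a. (fst a, ?D (snd a)))) (at ?z)"
    by (subst has_derivative_cong_open[OF oU z, of _ "\<lambda>z. (fst z, (coord d \<circ> cinv c) (snd z))"])
      (simp_all only: cylinder_transition[OF cd(1)])
  then have "frechet_derivative (coord (cylinder_chart d) \<circ> cinv (cylinder_chart c)) (at ?z) =
      (\<lambda>a. (fst a, ?D (snd a)))"
    by (rule frechet_derivative_at[symmetric])
  then show ?thesis by (simp only:)
qed

lemma coord_vector_cylinder:
  assumes "c \<in> charts_at A (snd p)" "d \<in> charts_at A (snd p)"
  shows "coord_vector (RS A) (cylinder_chart c) p a (cylinder_chart d) =
    (fst a, coord_vector A c (snd p) (snd a) d)"
  using assms cylinder_transition_derivative[OF assms] cylinder_chart_at[OF assms(2)]
  by (simp add: coord_vector_def)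

text \<open>
  In every cylinder \<open>\<partial>\<^sub>t\<close> is the constant vector \<open>(1, 0)\<close>. Hence \<open>g(\<cdot>, K)\<close> and \<open>g(K, K)\<close> are
  ordinary components of \<open>g\<close>, and the Lie derivative along \<open>K\<close> is the partial derivative in \<open>t\<close>.
\<close>

lemma K_field_eq_coord_vector:
  assumes "c \<in> charts_at A (snd p)"
  shows "K_field A p = coord_vector (RS A) (cylinder_chart c) p (1, 0)"
proof
  fix e
  show "K_field A p e = coord_vector (RS A) (cylinder_chart c) p (1, 0) e"
  proof (cases "e \<in> charts_at (RS A) p")
    case True
    then obtain d where d: "e = cylinder_chart d" "d \<in> charts_at A (snd p)"
      by (auto simp: charts_at_RS)
    have "((\<lambda>t. coord e (t, snd p)) has_vector_derivative (1, 0)) (at (fst p))"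
      using has_vector_derivative_Pair[OF has_vector_derivative_id has_vector_derivative_const]
      by (simp add: d(1) coord_cylinder_chart)
    then have "K_field A p e = (1, 0)"
      using True by (simp add: K_field_def vector_derivative_at)
    moreover have "frechet_derivative (coord d \<circ> cinv c) (at (coord c (snd p))) 0 = 0"
      by (rule linear_0[OF transition_derivative_linear[OF A assms d(2)]])
    ultimately show ?thesis
      using d True cylinder_transition_derivative[OF assms d(2), of "(1, 0)"]
      by (simp add: coord_vector_def)
  qed (simp add: K_field_def coord_vector_def)
qed

lemma K_field_component: "c \<in> charts_at A (snd p) \<Longrightarrow> K_field A p (cylinder_chart c) = (1, 0)"
  by (simp add: K_field_eq_coord_vector coord_vector_component[OF smooth_atlas_RS cylinder_chart_at])

lemma K_field_in_tangent_space: "K_field A p \<in> tangent_space (RS A) p"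
proof -
  obtain c where c: "c \<in> charts_at A (snd p)" using exists_chart_at[OF A] by blast
  show ?thesis
    unfolding K_field_eq_coord_vector[OF c]
    by (rule coord_vector_in_tangent_space[OF smooth_atlas_RS cylinder_chart_at[OF c]])
qed

lemma K_field_nonzero: "K_field A p \<noteq> (\<lambda>_. 0)"
proof -
  obtain c where c: "c \<in> charts_at A (snd p)" using exists_chart_at[OF A] by blast
  show ?thesis
  proof
    assume "K_field A p = (\<lambda>_. 0)"
    then have "(0::real \<times> 'e) = (1, 0)" using K_field_component[OF c] by metis
    then show False by (simp add: prod_eq_iff)
  qed
qed

lemma K_field_cinv:
  assumes "c \<in> A" "z \<in> cimg (cylinder_chart c)"
  shows "K_field A (cinv (cylinder_chart c) z) =
      coord_vector (RS A) (cylinder_chart c) (cinv (cylinder_chart c) z) (1, 0)"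
    and "K_field A (cinv (cylinder_chart c) z) (cylinder_chart c) = (1, 0)"
proof -
  have "c \<in> charts_at A (snd (cinv (cylinder_chart c) z))"
    using assms by (auto simp: cinv_cylinder_chart cimg_cylinder_chart cinv_charts_at[OF A])
  then show "K_field A (cinv (cylinder_chart c) z) =
      coord_vector (RS A) (cylinder_chart c) (cinv (cylinder_chart c) z) (1, 0)"
    and "K_field A (cinv (cylinder_chart c) z) (cylinder_chart c) = (1, 0)"
    using K_field_eq_coord_vector K_field_component by blast+
qed

lemma vector_field_K_field: "vector_field (RS A) (K_field A)"
  unfolding vector_field_def RS_eq_cylinder_charts ball_simps
proof (intro conjI allI ballI)
  show "K_field A p \<in> tangent_space (cylinder_chart ` A) p" for p
    using K_field_in_tangent_space by (simp add: RS_eq_cylinder_charts)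
next
  fix c assume c: "c \<in> A"
  have "open (cimg (cylinder_chart c))"
    by (simp add: cimg_cylinder_chart open_Times chart_open_image[OF A c])
  then show "smooth_on (cimg (cylinder_chart c))
      (\<lambda>z. K_field A (cinv (cylinder_chart c) z) (cylinder_chart c))"
    by (rule smooth_on_cong[OF _ _ smooth_on_const[of _ "(1, 0)"]]) (simp only: K_field_cinv(2)[OF c])
qed

text \<open>
  The definition of \<^const>\<open>dt_form\<close> goes through an arbitrarily selected chart; the block diagonal
  form of the transitions makes the outcome the first component in any cylinder.
\<close>

lemma dt_form_component:
  assumes "c \<in> charts_at A (snd p)" "w \<in> tangent_space (RS A) p"
  shows "dt_form A p w = fst (w (cylinder_chart c))"
proof -
  define e where "e = (SOME e. e \<in> charts_at (RS A) p)"
  have "e \<in> charts_at (RS A) p"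
    unfolding e_def by (rule someI_ex[OF exists_chart_at[OF smooth_atlas_RS]])
  then obtain d where d: "e = cylinder_chart d" "d \<in> charts_at A (snd p)"
    by (auto simp: charts_at_RS)
  have dA: "d \<in> A" using d(2) by (simp add: charts_at_def)
  have oU: "open (cimg e)"
    unfolding d(1) by (simp add: cimg_cylinder_chart open_Times chart_open_image[OF A dA])
  have z: "coord e p \<in> cimg e"
    using d(2) by (auto simp: d(1) charts_at_def cimg_cylinder_chart coord_cylinder_chart coord_in_cimg)
  have line: "coord (UNIV, \<lambda>t::real. t) = (\<lambda>t. t)" "(UNIV, \<lambda>t::real. t) \<in> charts_at line_atlas s" for s
    by (simp_all add: coord_def charts_at_def line_atlas_def cdom_def)
  have "frechet_derivative (coord (UNIV, \<lambda>t::real. t) \<circ> fst \<circ> cinv e) (at (coord e p)) =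
      frechet_derivative fst (at (coord e p))"
    by (rule frechet_derivative_cong_open[OF oU z])
      (auto simp: d(1) line cimg_cylinder_chart cinv_cylinder_chart[OF dA])
  also have "\<dots> = fst"
    by (rule frechet_derivative_at[symmetric]) (rule linear_imp_has_derivative[OF linear_fst])
  finally have "dt_form A p w = fst (w (cylinder_chart d))"
    using line by (simp add: dt_form_def tangent_map_def Let_def e_def[symmetric] d(1))
  moreover have "fst (w (cylinder_chart d)) = fst (w (cylinder_chart c))"
    using coord_vector_cylinder[OF assms(1) d(2), of "w (cylinder_chart c)"]
      coord_vector_of_component[OF smooth_atlas_RS cylinder_chart_at[OF assms(1)] assms(2)] by simp
  ultimately show ?thesis by simp
qed

lemma space_part_eq_coord_vector:
  assumes "c \<in> charts_at A (snd p)" "w \<in> tangent_space (RS A) p"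
  shows "space_part A p w = coord_vector A c (snd p) (snd (w (cylinder_chart c)))"
proof
  fix d'
  define e where "e = (SOME e. e \<in> charts_at (RS A) p)"
  have "e \<in> charts_at (RS A) p"
    unfolding e_def by (rule someI_ex[OF exists_chart_at[OF smooth_atlas_RS]])
  then obtain d where d: "e = cylinder_chart d" "d \<in> charts_at A (snd p)"
    by (auto simp: charts_at_RS)
  have dA: "d \<in> A" using d(2) by (simp add: charts_at_def)
  have oU: "open (cimg e)"
    unfolding d(1) by (simp add: cimg_cylinder_chart open_Times chart_open_image[OF A dA])
  have z: "coord e p \<in> cimg e"
    using d(2) by (auto simp: d(1) charts_at_def cimg_cylinder_chart coord_cylinder_chart coord_in_cimg)
  have snd_z: "snd (coord e p) = coord d (snd p)"
    by (simp add: d(1) coord_cylinder_chart)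
  have wd: "w (cylinder_chart d) = coord_vector (RS A) (cylinder_chart c) p (w (cylinder_chart c)) (cylinder_chart d)"
    using coord_vector_of_component[OF smooth_atlas_RS cylinder_chart_at[OF assms(1)] assms(2)] by simp
  show "space_part A p w d' = coord_vector A c (snd p) (snd (w (cylinder_chart c))) d'"
  proof (cases "d' \<in> charts_at A (snd p)")
    case True
    let ?D = "frechet_derivative (coord d' \<circ> cinv d) (at (coord d (snd p)))"
    have "((coord d' \<circ> cinv d) has_derivative ?D) (at (snd (coord e p)))"
      using transition_has_derivative[OF A d(2) True] by (simp add: snd_z)
    from has_derivative_compose[OF has_derivative_snd[OF has_derivative_ident] this]
    have "((\<lambda>z. (coord d' \<circ> cinv d) (snd z)) has_derivative (\<lambda>a. ?D (snd a))) (at (coord e p))" .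
    then have "((coord d' \<circ> snd \<circ> cinv e) has_derivative (\<lambda>a. ?D (snd a))) (at (coord e p))"
      by (subst has_derivative_cong_open[OF oU z, of _ "\<lambda>z. (coord d' \<circ> cinv d) (snd z)"])
        (auto simp: d(1) cimg_cylinder_chart cinv_cylinder_chart[OF dA])
    then have "frechet_derivative (coord d' \<circ> snd \<circ> cinv e) (at (coord e p)) = (\<lambda>a. ?D (snd a))"
      by (rule frechet_derivative_at[symmetric])
    then have "space_part A p w d' = ?D (snd (w (cylinder_chart d)))"
      using True by (simp add: space_part_def tangent_map_def Let_def e_def[symmetric] d(1))
    also have "snd (w (cylinder_chart d)) =
        coord_vector A c (snd p) (snd (w (cylinder_chart c))) d"
      by (simp add: wd coord_vector_cylinder[OF assms(1) d(2)])
    finally show ?thesis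
      by (simp only: coord_vector_def True d(2) if_True
          transition_derivative_cocycle[OF A assms(1) d(2) True])
  qed (simp add: space_part_def tangent_map_def Let_def coord_vector_def)
qed

lemma space_part_component:
  "c \<in> charts_at A (snd p) \<Longrightarrow> w \<in> tangent_space (RS A) p \<Longrightarrow>
    space_part A p w c = snd (w (cylinder_chart c))"
  by (simp add: space_part_eq_coord_vector coord_vector_component[OF A])

lemma space_part_in_tangent_space:
  assumes "w \<in> tangent_space (RS A) p"
  shows "space_part A p w \<in> tangent_space A (snd p)"
proof -
  obtain c where c: "c \<in> charts_at A (snd p)" using exists_chart_at[OF A] by blast
  show ?thesis
    unfolding space_part_eq_coord_vector[OF c assms] by (rule coord_vector_in_tangent_space[OF A c])
qed

lemma horizontal_lift_eq_coord_vector: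
  assumes "c \<in> charts_at A (snd p)" "v \<in> tangent_space A (snd p)"
  shows "horizontal_lift A p v = coord_vector (RS A) (cylinder_chart c) p (0, v c)"
proof -
  define d where "d = (SOME c. c \<in> charts_at A (snd p))"
  have d: "d \<in> charts_at A (snd p)"
    unfolding d_def by (rule someI_ex[OF exists_chart_at[OF A]])
  have "coord_vector (RS A) (cylinder_chart d) p (0, v d) (cylinder_chart c) = (0, v c)"
    by (simp add: coord_vector_cylinder[OF d assms(1)] coord_vector_of_component[OF A d assms(2)])
  with coord_vector_of_component[OF smooth_atlas_RS cylinder_chart_at[OF assms(1)]
      coord_vector_in_tangent_space[OF smooth_atlas_RS cylinder_chart_at[OF d]], of "(0, v d)"]
  show ?thesis
    unfolding horizontal_lift_def Let_def d_def[symmetric] by simp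
qed

lemma horizontal_lift_in_tangent_space: "horizontal_lift A p v \<in> tangent_space (RS A) p"
  unfolding horizontal_lift_def Let_def
  by (rule coord_vector_in_tangent_space[OF smooth_atlas_RS cylinder_chart_at])
    (rule someI_ex[OF exists_chart_at[OF A]])

lemma horizontal_lift_component:
  assumes "c \<in> charts_at A (snd p)" "v \<in> tangent_space A (snd p)"
  shows "horizontal_lift A p v (cylinder_chart c) = (0, v c)"
  unfolding horizontal_lift_eq_coord_vector[OF assms]
  by (rule coord_vector_component[OF smooth_atlas_RS cylinder_chart_at[OF assms(1)]])

lemma horizontal_lift_combination:
  assumes "v \<in> tangent_space A (snd p)" "w \<in> tangent_space A (snd p)"
  shows "horizontal_lift A p (\<lambda>c. r *\<^sub>R v c + s *\<^sub>R w c) =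
    (\<lambda>e. r *\<^sub>R horizontal_lift A p v e + s *\<^sub>R horizontal_lift A p w e)"
proof -
  obtain c where c: "c \<in> charts_at A (snd p)" using exists_chart_at[OF A] by blast
  have "(0, r *\<^sub>R v c + s *\<^sub>R w c) = r *\<^sub>R (0::real, v c) + s *\<^sub>R (0, w c)" by simp
  then show ?thesis
    by (simp only: horizontal_lift_eq_coord_vector[OF c assms(1)]
        horizontal_lift_eq_coord_vector[OF c assms(2)]
        horizontal_lift_eq_coord_vector[OF c tangent_space_combination[OF A assms]]
        coord_vector_combination[OF smooth_atlas_RS cylinder_chart_at[OF c]])
qed

lemma dt_form_K_field: "dt_form A p (K_field A p) = 1"
  and space_part_K_field: "space_part A p (K_field A p) = (\<lambda>_. 0)"
proof -
  obtain c where c: "c \<in> charts_at A (snd p)" using exists_chart_at[OF A] by blast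
  show "dt_form A p (K_field A p) = 1"
    by (simp add: dt_form_component[OF c K_field_in_tangent_space] K_field_component[OF c])
  show "space_part A p (K_field A p) = (\<lambda>_. 0)"
    by (rule tangent_vector_eqI[OF A c space_part_in_tangent_space[OF K_field_in_tangent_space]
          tangent_space_zero[OF A]])
      (simp add: space_part_component[OF c K_field_in_tangent_space] K_field_component[OF c])
qed

end

section \<open>Symmetric tensors\<close>

lemma sym_tensor2_commute:
  "sym_tensor2 M g \<Longrightarrow> v \<in> tangent_space M p \<Longrightarrow> w \<in> tangent_space M p \<Longrightarrow> g p v w = g p w v"
  unfolding sym_tensor2_def by blast

lemma sym_tensor2_off_tangent:
  "sym_tensor2 M g \<Longrightarrow> v \<notin> tangent_space M p \<or> w \<notin> tangent_space M p \<Longrightarrow> g p v w = 0"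
  unfolding sym_tensor2_def by blast

lemma sym_tensor2_left:
  assumes "sym_tensor2 M g" "u \<in> tangent_space M p" "v \<in> tangent_space M p" "w \<in> tangent_space M p"
  shows "g p (\<lambda>c. a *\<^sub>R u c + b *\<^sub>R v c) w = a * g p u w + b * g p v w"
  using assms unfolding sym_tensor2_def by blast

lemma sym_tensor2_right:
  assumes M: "smooth_atlas M" and g: "sym_tensor2 M g"
    and uvw: "u \<in> tangent_space M p" "v \<in> tangent_space M p" "w \<in> tangent_space M p"
  shows "g p w (\<lambda>c. a *\<^sub>R u c + b *\<^sub>R v c) = a * g p w u + b * g p w v"
  using sym_tensor2_left[OF g uvw] sym_tensor2_commute[OF g uvw(3)]
    tangent_space_combination[OF M uvw(1,2)] uvw by simp

lemma sym_tensor2_smooth_components: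
  "sym_tensor2 M g \<Longrightarrow> c \<in> M \<Longrightarrow> smooth_on (cimg c) (\<lambda>x. components M g c x a b)"
  unfolding sym_tensor2_def by blast

lemma components_commute:
  assumes "smooth_atlas M" "sym_tensor2 M g" "c \<in> M" "x \<in> cimg c"
  shows "components M g c x a b = components M g c x b a"
  unfolding components_def
  by (intro sym_tensor2_commute[OF assms(2)] coord_vector_in_tangent_space[OF assms(1)]
      cinv_charts_at[OF assms(1,3,4)])

lemma components_left:
  assumes "smooth_atlas M" "sym_tensor2 M g" "c \<in> M" "x \<in> cimg c"
  shows "components M g c x (r *\<^sub>R a + s *\<^sub>R b) e = r * components M g c x a e + s * components M g c x b e"
proof -
  note c = cinv_charts_at[OF assms(1,3,4)]
  show ?thesis
    unfolding components_def coord_vector_combination[OF assms(1) c]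
    by (intro sym_tensor2_left[OF assms(2)] coord_vector_in_tangent_space[OF assms(1) c])
qed

lemma components_linear:
  assumes "smooth_atlas M" "sym_tensor2 M g" "c \<in> M" "x \<in> cimg c"
  shows "linear (\<lambda>a. components M g c x a e)"
  using components_left[OF assms, of 1 _ 1 _ e] components_left[OF assms, of _ _ 0 0 e]
  by (intro linearI) simp_all

section \<open>Reflecting a positive definite form in a line\<close>

text \<open>
  The reflected form \<open>C\<close> is \<open>B\<close> composed in one argument with the \<open>B\<close>-reflection in the hyperplane
  orthogonal to \<open>k\<close>: it agrees with \<open>B\<close> on that hyperplane and is \<open>- B\<close> on the line through \<open>k\<close>. The
  line gives a negative definite subspace of dimension one. There is none of larger dimension, since
  on any such subspace the functional \<open>B(\<cdot>, k)\<close> is injective: in its kernel \<open>C\<close> equals \<open>B\<close> and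
  cannot be negative.
\<close>

lemma
  fixes B :: "'a::euclidean_space \<Rightarrow> 'a \<Rightarrow> real"
  assumes lin: "\<And>b. linear (\<lambda>a. B a b)" and sym: "\<And>a b. B a b = B b a"
    and pos: "\<And>a. a \<noteq> 0 \<Longrightarrow> B a a > 0" and k: "k \<noteq> 0"
  defines "C \<equiv> \<lambda>a b. B a b - 2 * (B a k * B b k) / B k k"
  shows nondegenerate_reflected_form: "nondegenerate C"
    and form_index_reflected_form: "form_index C = 1"
proof -
  have kk: "B k k > 0" using pos k .
  have Cak: "C a k = - B a k" for a using kk by (simp add: C_def)
  have Caa: "C a a = B a a" if "B a k = 0" for a using that by (simp add: C_def)
  show "nondegenerate C"
    unfolding nondegenerate_def
  proof (intro allI impI)
    fix a assume a: "\<forall>b. C a b = 0"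
    then have "B a k = 0" using Cak[of a] by simp
    then have "B a a = 0" using a Caa by metis
    then show "a = 0" using pos[of a] by force
  qed
  let ?D = "{dim W | W. subspace W \<and> (\<forall>a\<in>W. a \<noteq> 0 \<longrightarrow> C a a < 0)}"
  have le: "n \<le> 1" if "n \<in> ?D" for n
  proof -
    from that obtain W where W: "n = dim W" "subspace W" "\<forall>a\<in>W. a \<noteq> 0 \<longrightarrow> C a a < 0" by blast
    have zero: "a = 0" if "a \<in> W" "B a k = 0" for a
      using W(3) that Caa[of a] pos[of a] by force
    have "inj_on (\<lambda>a. B a k) W"
      by (rule linear_inj_on_iff_eq_0[OF lin W(2), THEN iffD2]) (use zero in blast)
    then have "dim ((\<lambda>a. B a k) ` W) = dim W"
      using dim_image_eq[OF lin] W(2) by (metis span_eq_iff)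
    then show ?thesis using W(1) dim_subset_UNIV[of "(\<lambda>a. B a k) ` W"] by simp
  qed
  have dim1: "1 = dim (span {k})"
    using k dim_span_eq_card_independent[of "{k}"] by simp
  have neg: "C a a < 0" if "a \<in> span {k}" "a \<noteq> 0" for a
  proof -
    from that(1) obtain r where a: "a = r *\<^sub>R k" unfolding span_singleton by blast
    have "B a b = r * B k b" for b using linear_scale[OF lin, of r k b] by (simp add: a)
    then have "C a a = - (r * r * B k k)" using kk sym[of k a] by (simp add: C_def)
    moreover have "r * r > 0" using that(2) a by (metis not_real_square_gt_zero scale_zero_left)
    ultimately show ?thesis using kk by simp
  qed
  have "1 \<in> ?D"
    by (intro CollectI exI[of _ "span {k}"] conjI dim1 subspace_span ballI impI neg)
  moreover have "finite ?D" using le by (meson finite_nat_set_iff_bounded_le)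
  ultimately show "form_index C = 1"
    unfolding form_index_def by (intro Max_eqI le)
qed

section \<open>The reflection of a metric in the line spanned by the time direction\<close>

lemma Psi_K_right:
  fixes g :: "(real \<times> 's, real \<times> 'e::euclidean_space) tensor2"
  assumes "g p (K_field A p) (K_field A p) \<noteq> 0"
  shows "Psi A g p v (K_field A p) = - g p v (K_field A p)"
  using assms by (simp add: Psi_def)

text \<open>
  By \<open>Psi_K_right\<close> the reflected metric has \<open>g(\<cdot>, K)\<close> and \<open>g(K, K)\<close> negated, so the correction term
  \<open>2 g(v, K) g(w, K) / g(K, K)\<close> changes sign and the second application cancels the first.
  Consequently one formula gives both the map and its inverse.
\<close>

lemma Psi_involution:
  assumes "\<And>p. g p (K_field A p) (K_field A p) \<noteq> 0"
  shows "Psi A (Psi A g) = g"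
proof (intro ext)
  fix p v w
  have "Psi A (Psi A g) p v w = Psi A g p v w + 2 * (g p v (K_field A p) * g p w (K_field A p)) /
      g p (K_field A p) (K_field A p)"
    by (simp add: Psi_def[of A "Psi A g"] Psi_K_right assms)
  then show "Psi A (Psi A g) p v w = g p v w" by (simp add: Psi_def)
qed

text \<open>
  If \<open>d\<psi>(K) = K\<close> and \<open>\<psi>\<^sup>*g = \<mu> g\<close>, then \<open>g(v, K)\<close>, \<open>g(w, K)\<close> and \<open>g(K, K)\<close> all scale by \<open>\<mu>\<close>, and so does
  the correction term, which is homogeneous of degree one in them. The conformal factor is therefore
  the same for both metrics, and by involutivity the converse implication is another instance.
\<close>

lemma Psi_conformal_map:
  assumes K: "\<And>p. K_field A p \<in> tangent_space (RS A) p"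
    and \<psi>: "conformal_map (RS A) g \<psi>" "preserves_field (RS A) (K_field A) \<psi>"
  shows "conformal_map (RS A) (Psi A g) \<psi>"
proof -
  obtain \<mu> where \<mu>: "\<And>p. \<mu> p > 0"
    "\<And>p v w. v \<in> tangent_space (RS A) p \<Longrightarrow> w \<in> tangent_space (RS A) p \<Longrightarrow>
      g (\<psi> p) (tangent_map (RS A) (RS A) \<psi> p v) (tangent_map (RS A) (RS A) \<psi> p w) = \<mu> p * g p v w"
    using \<psi>(1) unfolding conformal_map_def by metis
  have d\<psi>K: "K_field A (\<psi> p) = tangent_map (RS A) (RS A) \<psi> p (K_field A p)" for p
    using \<psi>(2) unfolding preserves_field_def by metis
  have "Psi A g (\<psi> p) (tangent_map (RS A) (RS A) \<psi> p v) (tangent_map (RS A) (RS A) \<psi> p w) =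
      \<mu> p * Psi A g p v w"
    if "v \<in> tangent_space (RS A) p" "w \<in> tangent_space (RS A) p" for p v w
    using \<mu>(1)[of p] by (simp add: Psi_def d\<psi>K \<mu>(2) that K right_diff_distrib)
  then show ?thesis
    using \<psi>(1) \<mu>(1) unfolding conformal_map_def by blast
qed

text \<open>
  The reference time \<open>0\<close> is the one at which the coefficients of the standard form are read off.
\<close>

definition time_independent ::
  "('s, 'e::euclidean_space) chart set \<Rightarrow> (real \<times> 's, real \<times> 'e) tensor2 \<Rightarrow> bool" where
  "time_independent M g \<longleftrightarrow> (\<forall>c\<in>M. \<forall>y\<in>cimg c. \<forall>t a b.
     components (RS M) g (cylinder_chart c) (t, y) a b = components (RS M) g (cylinder_chart c) (0, y) a b)"

context
  fixes A :: "('s::topological_space, 'e::euclidean_space) chart set"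
  assumes A: "smooth_atlas A"
begin

lemma cylinder_chart_in_RS: "c \<in> A \<Longrightarrow> cylinder_chart c \<in> RS A"
  by (simp add: RS_eq_cylinder_charts)

lemma cylinder_image_open: "c \<in> A \<Longrightarrow> open (cimg (cylinder_chart c))"
  by (rule chart_open_image[OF smooth_atlas_RS[OF A] cylinder_chart_in_RS])

lemma components_Psi:
  assumes "c \<in> A" "z \<in> cimg (cylinder_chart c)"
  shows "components (RS A) (Psi A g) (cylinder_chart c) z a b =
    components (RS A) g (cylinder_chart c) z a b -
    2 * (components (RS A) g (cylinder_chart c) z a (1, 0) *
         components (RS A) g (cylinder_chart c) z b (1, 0)) /
    components (RS A) g (cylinder_chart c) z (1, 0) (1, 0)"
  by (simp add: components_def Psi_def K_field_cinv(1)[OF A assms])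

lemma components_K_K:
  assumes "c \<in> A" "z \<in> cimg (cylinder_chart c)"
  shows "components (RS A) g (cylinder_chart c) z (1, 0) (1, 0) =
    g (cinv (cylinder_chart c) z) (K_field A (cinv (cylinder_chart c) z)) (K_field A (cinv (cylinder_chart c) z))"
  by (simp add: components_def K_field_cinv(1)[OF A assms])

text \<open>
  Smoothness is the point of substance: in a cylinder the components of the new tensor are a rational
  expression in components of the old one, whose denominator \<open>g(K, K)\<close> has no zero.
\<close>

lemma sym_tensor2_Psi:
  assumes g: "sym_tensor2 (RS A) g" and KK: "\<And>p. g p (K_field A p) (K_field A p) \<noteq> 0"
  shows "sym_tensor2 (RS A) (Psi A g)"
  unfolding sym_tensor2_def
proof (intro conjI allI impI ballI)
  note K = K_field_in_tangent_space[OF A]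
  fix p v w
  show "Psi A g p v w = 0" if "v \<notin> tangent_space (RS A) p \<or> w \<notin> tangent_space (RS A) p"
    using sym_tensor2_off_tangent[OF g, of v p] sym_tensor2_off_tangent[OF g, of w p] that
    unfolding Psi_def by (elim disjE) simp_all
  assume vw: "v \<in> tangent_space (RS A) p" "w \<in> tangent_space (RS A) p"
  show "Psi A g p v w = Psi A g p w v"
    using sym_tensor2_commute[OF g vw] by (simp add: Psi_def mult.commute)
next
  note K = K_field_in_tangent_space[OF A]
  fix p u v w and a b :: real
  assume uvw: "u \<in> tangent_space (RS A) p" "v \<in> tangent_space (RS A) p" "w \<in> tangent_space (RS A) p"
  show "Psi A g p (\<lambda>c. a *\<^sub>R u c + b *\<^sub>R v c) w = a * Psi A g p u w + b * Psi A g p v w"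
    unfolding Psi_def sym_tensor2_left[OF g uvw] sym_tensor2_left[OF g uvw(1,2) K]
    by (simp add: algebra_simps add_divide_distrib)
next
  fix c' and a b :: "real \<times> 'e"
  assume "c' \<in> RS A"
  then obtain c where c': "c' = cylinder_chart c" and c: "c \<in> A" by (auto simp: RS_eq_cylinder_charts)
  let ?k = "(1, 0) :: real \<times> 'e"
  let ?B = "\<lambda>z. components (RS A) g c' z"
  note open_img = cylinder_image_open[OF c, folded c']
  have sm: "Ck_on k (cimg c') (\<lambda>z. ?B z a b)" for k a b
    using sym_tensor2_smooth_components[OF g cylinder_chart_in_RS[OF c]] by (simp add: c' smooth_on_def)
  have nz: "?B z ?k ?k \<noteq> 0" if "z \<in> cimg c'" for z
    using that KK by (simp add: c' components_K_K[OF c])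
  have "Ck_on k (cimg c') (\<lambda>z. ?B z a b + (- 2) * (?B z a ?k * ?B z b ?k) * inverse (?B z ?k ?k))" for k
    by (intro Ck_on_add Ck_on_mult Ck_on_inverse Ck_on_const sm open_img nz)
  then have "smooth_on (cimg c') (\<lambda>z. ?B z a b + (- 2) * (?B z a ?k * ?B z b ?k) * inverse (?B z ?k ?k))"
    by (simp add: smooth_on_def)
  then show "smooth_on (cimg c') (\<lambda>z. components (RS A) (Psi A g) c' z a b)"
    by (rule smooth_on_cong[OF open_img, rotated]) (simp add: c' components_Psi[OF c] field_simps)
qed

section \<open>Killing metrics are the time independent ones\<close>

text \<open>
  The terms of the Lie derivative that contain derivatives of the field drop out, as \<open>K\<close> has constant
  components.
\<close>

lemma lie_derivative_K_field:
  assumes "sym_tensor2 (RS A) g" "c \<in> A" "z \<in> cimg (cylinder_chart c)"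
  shows "lie_derivative (RS A) (K_field A) g (cylinder_chart c) z a b =
    frechet_derivative (\<lambda>z. components (RS A) g (cylinder_chart c) z a b) (at z) (1, 0)"
proof -
  let ?c = "cylinder_chart c"
  note comp = smooth_atlas_RS[OF A] assms(1) cylinder_chart_in_RS[OF assms(2)] assms(3)
  have "frechet_derivative (\<lambda>z. K_field A (cinv ?c z) ?c) (at z) =
      frechet_derivative (\<lambda>z. (1, 0) :: real \<times> 'e) (at z)"
    by (rule frechet_derivative_cong_open[OF cylinder_image_open[OF assms(2)] assms(3)])
      (simp only: K_field_cinv(2)[OF A assms(2)])
  then have K0: "frechet_derivative (\<lambda>z. K_field A (cinv ?c z) ?c) (at z) e = 0" for e
    by simp
  have left0: "components (RS A) g ?c z 0 e = 0" for e
    using linear_0[OF components_linear[OF comp]] .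
  have right0: "components (RS A) g ?c z e 0 = 0" for e
    using components_commute[OF comp] left0 by metis
  show ?thesis
    by (simp add: lie_derivative_def K0 left0 right0 K_field_cinv(2)[OF A assms(2,3)])
qed

text \<open>
  A Killing metric has components with vanishing derivative in \<open>t\<close>. They are constant because the
  image of a cylinder contains the whole line \<open>\<real> \<times> {y}\<close> through each of its points.
\<close>

lemma killing_field_iff_time_independent:
  assumes g: "sym_tensor2 (RS A) g"
  shows "killing_field (RS A) g (K_field A) \<longleftrightarrow> time_independent A g"
proof -
  have deriv: "((\<lambda>t. components (RS A) g (cylinder_chart c) (t, y) a b) has_real_derivative
      lie_derivative (RS A) (K_field A) g (cylinder_chart c) (t, y) a b) (at t)"
    if "c \<in> A" "y \<in> cimg c" for c y t a b
  proof -
    let ?f = "\<lambda>z. components (RS A) g (cylinder_chart c) z a b"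
    let ?D = "frechet_derivative ?f (at (t, y))"
    have z: "(t, y) \<in> cimg (cylinder_chart c)" using that(2) by (simp add: cimg_cylinder_chart)
    have "?f differentiable (at (t, y))"
      by (rule smooth_on_differentiable[OF sym_tensor2_smooth_components[OF g cylinder_chart_in_RS[OF that(1)]] z])
    then have D: "(?f has_derivative ?D) (at (t, y))" by (simp add: frechet_derivative_works)
    have "((\<lambda>s. (s, y)) has_derivative (\<lambda>s. (s, 0))) (at t)"
      by (intro has_derivative_Pair has_derivative_ident has_derivative_const)
    from has_derivative_compose[OF this D]
    have "((\<lambda>s. ?f (s, y)) has_derivative (\<lambda>s. ?D (s, 0))) (at t)" .
    moreover have "(\<lambda>s. ?D (s, 0)) = (*) (?D (1, 0))"
    proof
      show "?D (s, 0) = ?D (1, 0) * s" for s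
        using linear_scale[OF has_derivative_linear[OF D], of s "(1, 0)"] by simp
    qed
    ultimately show ?thesis
      unfolding has_field_derivative_def lie_derivative_K_field[OF g that(1) z] by (simp only:)
  qed
  show ?thesis
  proof
    assume kf: "killing_field (RS A) g (K_field A)"
    have "components (RS A) g (cylinder_chart c) (t, y) a b =
        components (RS A) g (cylinder_chart c) (0, y) a b" if "c \<in> A" "y \<in> cimg c" for c y t a b
    proof -
      have "lie_derivative (RS A) (K_field A) g (cylinder_chart c) (s, y) a b = 0" for s
      proof -
        have "(s, y) \<in> cimg (cylinder_chart c)" using that(2) by (simp add: cimg_cylinder_chart)
        then show ?thesis using kf cylinder_chart_in_RS[OF that(1)] unfolding killing_field_def by blast
      qed
      then have "\<forall>s. ((\<lambda>t. components (RS A) g (cylinder_chart c) (t, y) a b)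
          has_real_derivative 0) (at s)"
        using deriv[OF that, of a b] by simp
      from DERIV_isconst_all[OF this] show ?thesis by blast
    qed
    then show "time_independent A g" unfolding time_independent_def by blast
  next
    assume ti: "time_independent A g"
    have "lie_derivative (RS A) (K_field A) g c' z a b = 0"
      if c'z: "c' \<in> RS A" "z \<in> cimg c'" for c' z a b
    proof -
      obtain c where c: "c' = cylinder_chart c" "c \<in> A"
        using c'z(1) unfolding RS_eq_cylinder_charts by blast
      obtain t y where z: "z = (t, y)" by (cases z)
      have y: "y \<in> cimg c" using c'z(2) by (simp add: c(1) z cimg_cylinder_chart)
      have const: "(\<lambda>t. components (RS A) g (cylinder_chart c) (t, y) a b) =
          (\<lambda>t. components (RS A) g (cylinder_chart c) (0, y) a b)"
        by (rule ext) (use ti c(2) y time_independent_def in blast)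
      show ?thesis
        unfolding c(1) z
        by (rule DERIV_unique[OF deriv[OF c(2) y]]) (unfold const, rule DERIV_const)
    qed
    then show "killing_field (RS A) g (K_field A)"
      unfolding killing_field_def using vector_field_K_field[OF A] by blast
  qed
qed

lemma time_independentD:
  "time_independent A g \<Longrightarrow> c \<in> A \<Longrightarrow> y \<in> cimg c \<Longrightarrow>
    components (RS A) g (cylinder_chart c) (t, y) a b = components (RS A) g (cylinder_chart c) (0, y) a b"
  unfolding time_independent_def by blast

text \<open>
  The new components are a function of the old ones at the same point, hence independent of \<open>t\<close>
  as well.
\<close>

lemma time_independent_Psi:
  assumes "time_independent A g"
  shows "time_independent A (Psi A g)"
  unfolding time_independent_def
proof (intro ballI allI)
  fix c y t a b
  assume c: "c \<in> A" "y \<in> cimg c"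
  have z: "(s, y) \<in> cimg (cylinder_chart c)" for s using c(2) by (simp add: cimg_cylinder_chart)
  show "components (RS A) (Psi A g) (cylinder_chart c) (t, y) a b =
      components (RS A) (Psi A g) (cylinder_chart c) (0, y) a b"
    by (simp only: components_Psi[OF c(1) z] time_independentD[OF assms c, of t])
qed

end

section \<open>Exchange of the Lorentzian and the Riemannian metrics\<close>

context
  fixes A :: "('s::topological_space, 'e::euclidean_space) chart set"
  assumes A: "smooth_atlas A"
begin

lemma one_form_zero: "one_form A \<omega> \<Longrightarrow> \<omega> x (\<lambda>_. 0) = 0"
proof -
  assume "one_form A \<omega>"
  then have "\<omega> x (\<lambda>c. 0 *\<^sub>R v c + 0 *\<^sub>R v c) = 0 * \<omega> x v + 0 * \<omega> x v"
    if "v \<in> tangent_space A x" for v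
    using that unfolding one_form_def by blast
  from this[OF tangent_space_zero[OF A]]
  show ?thesis by simp
qed

lemma sym_tensor2_zero:
  assumes "sym_tensor2 A g" "v \<in> tangent_space A x"
  shows "g x (\<lambda>_. 0) v = 0" and "g x v (\<lambda>_. 0) = 0"
  using sym_tensor2_left[OF assms(1) assms(2,2,2), of 0 0]
    sym_tensor2_right[OF A assms(1) assms(2,2,2), of 0 0] by simp_all

lemma SOM_sym_tensor2: "g \<in> SOM A \<Longrightarrow> sym_tensor2 (RS A) g"
  by (simp add: SOM_def lorentzian_metric_def)

text \<open>
  With \<open>\<tau> = dt(w)\<close> and \<open>v\<close> the space part of \<open>w\<close>, the standard form of \<open>g\<close> gives
  \<open>g(w, K) = - \<beta> \<tau> + \<omega>(v)\<close>, and completing the square turns \<open>g(w, w) + 2 g(w, K)\<^sup>2 / \<beta>\<close> into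
  \<open>(\<beta> \<tau> - \<omega>(v))\<^sup>2 / \<beta> + (g\<^sub>0(v, v) + \<omega>(v)\<^sup>2 / \<beta>)\<close>. The second summand is positive for \<open>v \<noteq> 0\<close>; for
  \<open>v = 0\<close> the first one is \<open>\<beta> \<tau>\<^sup>2\<close> with \<open>\<tau> \<noteq> 0\<close>. The coefficients do not involve \<open>t\<close>, whence the
  independence of time.
\<close>

lemma
  assumes g: "g \<in> SOM A"
  shows SOM_time_independent: "time_independent A g"
    and SOM_K_K: "g p (K_field A p) (K_field A p) < 0"
    and SOM_Psi_positive: "w \<in> tangent_space (RS A) p \<Longrightarrow> w \<noteq> (\<lambda>_. 0) \<Longrightarrow> Psi A g p w w > 0"
proof -
  from g obtain \<beta> \<omega> g\<^sub>0 where \<beta>: "\<And>x. \<beta> x > 0" and \<omega>: "one_form A \<omega>" and g\<^sub>0: "sym_tensor2 A g\<^sub>0"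
    and pos: "\<And>x v. v \<in> tangent_space A x \<Longrightarrow> v \<noteq> (\<lambda>_. 0) \<Longrightarrow> g\<^sub>0 x v v + 1 / \<beta> x * (\<omega> x v)\<^sup>2 > 0"
    and form: "\<And>t x w w'. w \<in> tangent_space (RS A) (t, x) \<Longrightarrow> w' \<in> tangent_space (RS A) (t, x) \<Longrightarrow>
           g (t, x) w w' =
             - \<beta> x * dt_form A (t, x) w * dt_form A (t, x) w'
             + dt_form A (t, x) w * \<omega> x (space_part A (t, x) w')
             + \<omega> x (space_part A (t, x) w) * dt_form A (t, x) w'
             + g\<^sub>0 x (space_part A (t, x) w) (space_part A (t, x) w')"
    unfolding SOM_def by blast
  show "time_independent A g"
    unfolding time_independent_def
  proof (intro ballI allI)
    fix c y t a b
    assume c: "c \<in> A" "y \<in> cimg c"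
    have "components (RS A) g (cylinder_chart c) (s, y) a b =
        - \<beta> (cinv c y) * fst a * fst b + fst a * \<omega> (cinv c y) (coord_vector A c (cinv c y) (snd b))
        + \<omega> (cinv c y) (coord_vector A c (cinv c y) (snd a)) * fst b
        + g\<^sub>0 (cinv c y) (coord_vector A c (cinv c y) (snd a)) (coord_vector A c (cinv c y) (snd b))" for s
    proof -
      have cs: "c \<in> charts_at A (snd (s, cinv c y))" using cinv_charts_at[OF A c] by simp
      have p: "cinv (cylinder_chart c) (s, y) = (s, cinv c y)"
        using c by (simp add: cinv_cylinder_chart[OF A])
      note T = coord_vector_in_tangent_space[OF smooth_atlas_RS[OF A] cylinder_chart_at[OF cs]]
      have dt: "dt_form A (s, cinv c y) (coord_vector (RS A) (cylinder_chart c) (s, cinv c y) e) = fst e" for e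
        by (simp only: dt_form_component[OF A cs T]
            coord_vector_component[OF smooth_atlas_RS[OF A] cylinder_chart_at[OF cs]])
      have sp: "space_part A (s, cinv c y) (coord_vector (RS A) (cylinder_chart c) (s, cinv c y) e) =
          coord_vector A c (cinv c y) (snd e)" for e
        by (simp only: space_part_eq_coord_vector[OF A cs T] snd_conv
            coord_vector_component[OF smooth_atlas_RS[OF A] cylinder_chart_at[OF cs]])
      show ?thesis unfolding components_def p form[OF T T] dt sp ..
    qed
    then show "components (RS A) g (cylinder_chart c) (t, y) a b =
        components (RS A) g (cylinder_chart c) (0, y) a b" by simp
  qed
  obtain t x where p: "p = (t, x)" by (cases p)
  note K = K_field_in_tangent_space[OF A, of "(t, x)"]
  have KK: "g p (K_field A p) (K_field A p) = - \<beta> x"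
    unfolding p form[OF K K]
    by (simp add: dt_form_K_field[OF A] space_part_K_field[OF A] one_form_zero[OF \<omega>]
        sym_tensor2_zero[OF g\<^sub>0 tangent_space_zero[OF A]])
  then show "g p (K_field A p) (K_field A p) < 0" using \<beta>[of x] by simp
  assume w: "w \<in> tangent_space (RS A) p" "w \<noteq> (\<lambda>_. 0)"
  define \<tau> where "\<tau> = dt_form A p w"
  define v where "v = space_part A p w"
  have v: "v \<in> tangent_space A x"
    using space_part_in_tangent_space[OF A w(1)] by (simp add: v_def p)
  have ww: "g p w w = - \<beta> x * \<tau>\<^sup>2 + 2 * \<tau> * \<omega> x v + g\<^sub>0 x v v"
    using form[OF w(1)[unfolded p] w(1)[unfolded p]]
    by (simp add: \<tau>_def v_def p power2_eq_square)
  have wK: "g p w (K_field A p) = - \<beta> x * \<tau> + \<omega> x v"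
    using form[OF w(1)[unfolded p] K]
    by (simp add: \<tau>_def v_def p dt_form_K_field[OF A] space_part_K_field[OF A] one_form_zero[OF \<omega>]
        sym_tensor2_zero[OF g\<^sub>0 v[unfolded v_def p]])
  have sq: "Psi A g p w w = (\<beta> x * \<tau> - \<omega> x v)\<^sup>2 / \<beta> x + (g\<^sub>0 x v v + 1 / \<beta> x * (\<omega> x v)\<^sup>2)"
    unfolding Psi_def ww wK KK using \<beta>[of x] by (simp add: field_simps power2_eq_square)
  show "Psi A g p w w > 0"
  proof (cases "v = (\<lambda>_. 0)")
    case True
    have "\<tau> \<noteq> 0"
    proof
      assume "\<tau> = 0"
      obtain c where c: "c \<in> charts_at A (snd p)" using exists_chart_at[OF A] by blast
      have "w (cylinder_chart c) = 0"
        using \<open>\<tau> = 0\<close> True dt_form_component[OF A c w(1)] space_part_component[OF A c w(1)]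
        by (simp add: \<tau>_def v_def prod_eq_iff)
      then have "w = (\<lambda>_. 0)"
        by (intro tangent_vector_eqI[OF smooth_atlas_RS[OF A] cylinder_chart_at[OF c] w(1)
              tangent_space_zero[OF smooth_atlas_RS[OF A]]])
      then show False using w(2) by contradiction
    qed
    then show ?thesis
      unfolding sq True one_form_zero[OF \<omega>] sym_tensor2_zero(1)[OF g\<^sub>0 tangent_space_zero[OF A]]
      using \<beta>[of x] by simp
  next
    case False
    have "(\<beta> x * \<tau> - \<omega> x v)\<^sup>2 / \<beta> x \<ge> 0" using \<beta>[of x] by simp
    then show ?thesis unfolding sq using pos[OF v False] by linarith
  qed
qed

lemma SOM_Psi_in_Stat:
  assumes g: "g \<in> SOM A"
  shows "Psi A g \<in> Stat\<^sub>R A"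
proof -
  have KK: "g p (K_field A p) (K_field A p) \<noteq> 0" for p using SOM_K_K[OF g, of p] by simp
  note sym = sym_tensor2_Psi[OF A SOM_sym_tensor2[OF g] KK]
  have "killing_field (RS A) (Psi A g) (K_field A)"
    unfolding killing_field_iff_time_independent[OF A sym]
    by (rule time_independent_Psi[OF A SOM_time_independent[OF g]])
  moreover have "riemannian_metric (RS A) (Psi A g)"
    unfolding riemannian_metric_def using sym SOM_Psi_positive[OF g] by blast
  ultimately show ?thesis by (simp add: Stat\<^sub>R_def)
qed

lemma
  assumes "h \<in> Stat\<^sub>R A"
  shows Stat_sym_tensor2: "sym_tensor2 (RS A) h"
    and Stat_time_independent: "time_independent A h"
    and Stat_positive: "\<And>p w. w \<in> tangent_space (RS A) p \<Longrightarrow> w \<noteq> (\<lambda>_. 0) \<Longrightarrow> h p w w > 0"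
    and Stat_K_K: "\<And>p. h p (K_field A p) (K_field A p) > 0"
proof -
  show sym: "sym_tensor2 (RS A) h"
    using assms by (simp add: Stat\<^sub>R_def riemannian_metric_def)
  show "time_independent A h"
    using assms killing_field_iff_time_independent[OF A sym] by (simp add: Stat\<^sub>R_def)
  show pos: "h p w w > 0" if "w \<in> tangent_space (RS A) p" "w \<noteq> (\<lambda>_. 0)" for p w
    using assms that unfolding Stat\<^sub>R_def riemannian_metric_def by blast
  show "h p (K_field A p) (K_field A p) > 0" for p
    by (rule pos[OF K_field_in_tangent_space[OF A] K_field_nonzero[OF A]])
qed

text \<open>
  Pointwise in each chart this is the statement about reflected positive definite forms, applied to
  \<open>k = (1, 0)\<close>.
\<close>

lemma Stat_Psi_lorentzian:
  assumes h: "h \<in> Stat\<^sub>R A"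
  shows "lorentzian_metric (RS A) (Psi A h)"
  unfolding lorentzian_metric_def
proof (intro conjI ballI)
  show "2 \<le> DIM(real \<times> 'e)" using DIM_positive[where 'a='e] by simp
  have "h p (K_field A p) (K_field A p) \<noteq> 0" for p using Stat_K_K[OF h, of p] by simp
  then show "sym_tensor2 (RS A) (Psi A h)"
    by (rule sym_tensor2_Psi[OF A Stat_sym_tensor2[OF h]])
next
  fix c' z
  assume c': "c' \<in> RS A" and z: "z \<in> cimg c'"
  then obtain c where c: "c' = cylinder_chart c" "c \<in> A" by (auto simp: RS_eq_cylinder_charts)
  let ?B = "components (RS A) h c' z"
  note comp = smooth_atlas_RS[OF A] Stat_sym_tensor2[OF h] c' z
  note cz = cinv_charts_at[OF smooth_atlas_RS[OF A] c' z]
  have pos: "?B a a > 0" if "a \<noteq> 0" for a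
  proof -
    have "coord_vector (RS A) c' (cinv c' z) a c' \<noteq> 0"
      using coord_vector_component[OF smooth_atlas_RS[OF A] cz, of a] that by simp
    then have "coord_vector (RS A) c' (cinv c' z) a \<noteq> (\<lambda>_. 0)" by metis
    then show ?thesis
      unfolding components_def
      by (intro Stat_positive[OF h] coord_vector_in_tangent_space[OF smooth_atlas_RS[OF A] cz])
  qed
  have k: "(1, 0) \<noteq> (0 :: real \<times> 'e)" by (simp add: prod_eq_iff)
  have eq: "components (RS A) (Psi A h) c' z =
      (\<lambda>a b. ?B a b - 2 * (?B a (1, 0) * ?B b (1, 0)) / ?B (1, 0) (1, 0))"
    by (intro ext) (simp only: c(1) components_Psi[OF A c(2) z[unfolded c(1)]])
  note lin = components_linear[OF comp] and sym = components_commute[OF comp]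
  show "nondegenerate (components (RS A) (Psi A h) c' z)"
    unfolding eq by (rule nondegenerate_reflected_form[of ?B, OF lin sym pos k])
  show "form_index (components (RS A) (Psi A h) c' z) = 1"
    unfolding eq by (rule form_index_reflected_form[of ?B, OF lin sym pos k])
qed

lemma horizontal_lift_coord_vector:
  assumes c: "c \<in> A" "y \<in> cimg c"
  shows "horizontal_lift A (t, cinv c y) (coord_vector A c (cinv c y) a) =
    coord_vector (RS A) (cylinder_chart c) (cinv (cylinder_chart c) (t, y)) (0, a)"
proof -
  have cs: "c \<in> charts_at A (cinv c y)" by (rule cinv_charts_at[OF A c])
  then show ?thesis
    using horizontal_lift_eq_coord_vector[OF A, of c "(t, cinv c y)"] c
    by (simp add: cinv_cylinder_chart[OF A] coord_vector_in_tangent_space[OF A cs]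
        coord_vector_component[OF A cs])
qed

text \<open>
  Restriction to \<open>t = 0\<close> turns components on the product into smooth functions on \<open>S\<close>; this is how
  the coefficients of the standard form acquire their smoothness.
\<close>

lemma smooth_components_time_slice:
  assumes "sym_tensor2 (RS A) g" "c \<in> A"
  shows "smooth_on (cimg c) (\<lambda>y. components (RS A) g (cylinder_chart c) (0, y) a b)"
proof (rule smooth_on_compose_linear[OF _ chart_open_image[OF A assms(2)] _
      sym_tensor2_smooth_components[OF assms(1) cylinder_chart_in_RS[OF A assms(2)]]])
  show "linear (\<lambda>y::'e. (0::real, y))" by (rule linearI) simp_all
qed (simp add: cimg_cylinder_chart)

text \<open>
  Equal components transport both vectors from time \<open>t\<close> to time \<open>0\<close> without changing the value of
  \<open>g\<close>; there the splitting of a vector into a multiple of \<open>K\<close> and a horizontal vector is expanded by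
  bilinearity. The result is the standard form with \<open>\<beta> = - g(K, K)\<close>, \<open>\<omega> = g(\<cdot>, K)\<close> and \<open>g\<^sub>0\<close> the
  restriction of \<open>g\<close> to horizontal vectors, all at time \<open>0\<close>.
\<close>

lemma time_independent_expansion:
  assumes g: "sym_tensor2 (RS A) g" and ti: "time_independent A g"
    and w: "w \<in> tangent_space (RS A) (t, x)" and w': "w' \<in> tangent_space (RS A) (t, x)"
  defines "K \<equiv> K_field A (0, x)"
    and "L \<equiv> \<lambda>w. horizontal_lift A (0, x) (space_part A (t, x) w)"
  shows "g (t, x) w w' =
    dt_form A (t, x) w * dt_form A (t, x) w' * g (0, x) K K
    + dt_form A (t, x) w * g (0, x) (L w') K
    + dt_form A (t, x) w' * g (0, x) (L w) K
    + g (0, x) (L w) (L w')"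
proof -
  obtain c where c: "c \<in> charts_at A x" using exists_chart_at[OF A] by blast
  let ?c = "cylinder_chart c"
  let ?B = "components (RS A) g ?c (0, coord c x)"
  have cs: "c \<in> charts_at A (snd (s, x))" for s :: real using c by simp
  have cA: "c \<in> A" "coord c x \<in> cimg c" using c by (auto simp: charts_at_def coord_in_cimg)
  have cimg0: "(0, coord c x) \<in> cimg ?c" using cA(2) by (simp add: cimg_cylinder_chart)
  have KT: "K \<in> tangent_space (RS A) (0, x)" unfolding K_def by (rule K_field_in_tangent_space[OF A])
  have LT: "L u \<in> tangent_space (RS A) (0, x)" for u
    unfolding L_def by (rule horizontal_lift_in_tangent_space[OF A])
  have B: "?B (u ?c) (u' ?c) = g (0, x) u u'"
    if "u \<in> tangent_space (RS A) (0, x)" "u' \<in> tangent_space (RS A) (0, x)" for u u'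
    using components_coord[OF smooth_atlas_RS[OF A] cylinder_chart_at[OF cs] that, of g]
    by (simp add: coord_cylinder_chart)
  have split: "u ?c = dt_form A (t, x) u *\<^sub>R K ?c + 1 *\<^sub>R L u ?c"
    if u: "u \<in> tangent_space (RS A) (t, x)" for u
    using space_part_in_tangent_space[OF A u]
    by (simp add: K_def L_def K_field_component[OF A cs] horizontal_lift_component[OF A cs]
        dt_form_component[OF A cs u] space_part_component[OF A cs u])
  note comp = smooth_atlas_RS[OF A] g cylinder_chart_in_RS[OF A cA(1)] cimg0
  have right: "?B e (r *\<^sub>R a + s *\<^sub>R b) = r * ?B e a + s * ?B e b" for r s a b e
    using components_left[OF comp, of r a s b e] components_commute[OF comp] by metis
  have "g (t, x) w w' = components (RS A) g ?c (t, coord c x) (w ?c) (w' ?c)"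
    using components_coord[OF smooth_atlas_RS[OF A] cylinder_chart_at[OF cs] w w', of g]
    by (simp add: coord_cylinder_chart)
  also have "\<dots> = ?B (w ?c) (w' ?c)" by (rule time_independentD[OF A ti cA])
  also have "\<dots> = dt_form A (t, x) w * (dt_form A (t, x) w' * g (0, x) K K + 1 * g (0, x) K (L w'))
      + 1 * (dt_form A (t, x) w' * g (0, x) (L w) K + 1 * g (0, x) (L w) (L w'))"
    unfolding split[OF w] split[OF w'] components_left[OF comp]
    unfolding right by (simp only: B KT LT)
  also have "g (0, x) K (L w') = g (0, x) (L w') K"
    by (rule sym_tensor2_commute[OF g KT LT])
  finally show ?thesis by (simp add: algebra_simps)
qed

text \<open>
  The coefficients are those of the expansion above. The inequality \<open>g\<^sub>0 + \<omega>\<^sup>2 / \<beta> > 0\<close> is a strict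
  Cauchy-Schwarz inequality for the Riemannian metric \<open>h\<close>: on the horizontal lift \<open>u\<close> of \<open>v \<noteq> 0\<close> the
  left hand side is \<open>h(u, u) - h(u, K)\<^sup>2 / h(K, K)\<close>, the squared length of the part of \<open>u\<close> orthogonal
  to \<open>K\<close>, and \<open>u\<close> is not a multiple of \<open>K\<close>.
\<close>

lemma Stat_Psi_in_SOM:
  assumes h: "h \<in> Stat\<^sub>R A"
  shows "Psi A h \<in> SOM A"
proof -
  define g where "g = Psi A h"
  let ?K = "\<lambda>x. K_field A (0, x)"
  let ?L = "\<lambda>x. horizontal_lift A (0, x)"
  define \<beta> where "\<beta> x = - g (0, x) (?K x) (?K x)" for x
  \<comment> \<open>Zero off the tangent spaces, as the conventions for one-forms and tensors demand.\<close>
  define \<omega> where "\<omega> x v = (if v \<in> tangent_space A x then g (0, x) (?L x v) (?K x) else 0)" for x v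
  define g\<^sub>0 where "g\<^sub>0 x v w = (if v \<in> tangent_space A x \<and> w \<in> tangent_space A x
    then g (0, x) (?L x v) (?L x w) else 0)" for x v w
  note KT = K_field_in_tangent_space[OF A] and LT = horizontal_lift_in_tangent_space[OF A]
  note comb = tangent_space_combination[OF A]
  have lor: "lorentzian_metric (RS A) g" unfolding g_def by (rule Stat_Psi_lorentzian[OF h])
  then have sym: "sym_tensor2 (RS A) g" by (simp add: lorentzian_metric_def)
  have ti: "time_independent A g"
    unfolding g_def by (rule time_independent_Psi[OF A Stat_time_independent[OF h]])
  have hKK: "h p (K_field A p) (K_field A p) > 0" for p by (rule Stat_K_K[OF h])
  have gK: "g p v (K_field A p) = - h p v (K_field A p)" for p v
    unfolding g_def using hKK[of p] by (intro Psi_K_right) simp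
  have \<beta>_pos: "\<beta> x > 0" for x using hKK by (simp add: \<beta>_def gK)
  have L_comb: "?L x (\<lambda>c. a *\<^sub>R u c + b *\<^sub>R v c) = (\<lambda>e. a *\<^sub>R ?L x u e + b *\<^sub>R ?L x v e)"
    if "u \<in> tangent_space A x" "v \<in> tangent_space A x" for x u v a b
    using horizontal_lift_combination[OF A, of u "(0, x)" v a b] that by simp
  have cv: "coord_vector A c (cinv c y) a \<in> tangent_space A (cinv c y)" if "c \<in> A" "y \<in> cimg c" for c y a
    by (rule coord_vector_in_tangent_space[OF A cinv_charts_at[OF A that]])
  have p0: "cinv (cylinder_chart c) (0, y) = (0, cinv c y)" "(0, y) \<in> cimg (cylinder_chart c)"
    if "c \<in> A" "y \<in> cimg c" for c y
    using that by (simp_all add: cinv_cylinder_chart[OF A] cimg_cylinder_chart)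
  have K0: "?K (cinv c y) = coord_vector (RS A) (cylinder_chart c) (0, cinv c y) (1, 0)"
    if "c \<in> A" "y \<in> cimg c" for c y
    using K_field_cinv(1)[OF A that(1) p0(2)[OF that]] by (simp only: p0(1)[OF that])
  have L0: "?L (cinv c y) (coord_vector A c (cinv c y) a) =
      coord_vector (RS A) (cylinder_chart c) (0, cinv c y) (0, a)"
    if "c \<in> A" "y \<in> cimg c" for c y a
    using horizontal_lift_coord_vector[OF that, of 0 a] by (simp only: p0(1)[OF that])
  have smooth_\<beta>: "smooth_fun A \<beta>"
    unfolding smooth_fun_def
  proof
    fix c assume c: "c \<in> A"
    have "smooth_on (cimg c) (\<lambda>y. - 1 * components (RS A) g (cylinder_chart c) (0, y) (1, 0) (1, 0))"
      by (intro smooth_on_mult smooth_on_const chart_open_image[OF A c]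
          smooth_components_time_slice[OF sym c])
    then show "smooth_on (cimg c) (\<beta> \<circ> cinv c)"
      by (rule smooth_on_cong[OF chart_open_image[OF A c], rotated])
        (simp add: components_def \<beta>_def K0[OF c] p0(1)[OF c])
  qed
  have form_\<omega>: "one_form A \<omega>"
    unfolding one_form_def
  proof (intro conjI allI impI ballI)
    show "\<omega> x v = 0" if "v \<notin> tangent_space A x" for x v using that by (simp add: \<omega>_def)
    show "\<omega> x (\<lambda>c. a *\<^sub>R v c + b *\<^sub>R w c) = a * \<omega> x v + b * \<omega> x w"
      if "v \<in> tangent_space A x" "w \<in> tangent_space A x" for x v w a b
      by (simp only: \<omega>_def that comb[OF that] if_True L_comb[OF that] sym_tensor2_left[OF sym LT LT KT])
    fix c a assume c: "c \<in> A"
    show "smooth_on (cimg c) (\<lambda>y. \<omega> (cinv c y) (coord_vector A c (cinv c y) a))"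
      by (rule smooth_on_cong[OF chart_open_image[OF A c] _
            smooth_components_time_slice[OF sym c, of "(0, a)" "(1, 0)"]])
        (simp only: components_def \<omega>_def K0[OF c] L0[OF c] p0(1)[OF c] cv[OF c] if_True)
  qed
  have sym_g\<^sub>0: "sym_tensor2 A g\<^sub>0"
    unfolding sym_tensor2_def
  proof (intro conjI allI impI ballI)
    show "g\<^sub>0 x v w = 0" if "v \<notin> tangent_space A x \<or> w \<notin> tangent_space A x" for x v w
      using that by (auto simp: g\<^sub>0_def)
    show "g\<^sub>0 x v w = g\<^sub>0 x w v" if "v \<in> tangent_space A x" "w \<in> tangent_space A x" for x v w
      using that sym_tensor2_commute[OF sym LT LT] by (simp add: g\<^sub>0_def)
    show "g\<^sub>0 x (\<lambda>c. a *\<^sub>R u c + b *\<^sub>R v c) w = a * g\<^sub>0 x u w + b * g\<^sub>0 x v w"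
      if uv: "u \<in> tangent_space A x" "v \<in> tangent_space A x" and w: "w \<in> tangent_space A x"
      for x u v w a b
      by (simp only: g\<^sub>0_def uv w comb[OF uv] simp_thms if_True L_comb[OF uv]
          sym_tensor2_left[OF sym LT LT LT])
    fix c a b assume c: "c \<in> A"
    show "smooth_on (cimg c) (\<lambda>y. components A g\<^sub>0 c y a b)"
      by (rule smooth_on_cong[OF chart_open_image[OF A c] _
            smooth_components_time_slice[OF sym c, of "(0, a)" "(0, b)"]])
        (simp only: components_def g\<^sub>0_def L0[OF c] p0(1)[OF c] cv[OF c] simp_thms if_True)
  qed
  have pos: "g\<^sub>0 x v v + 1 / \<beta> x * (\<omega> x v)\<^sup>2 > 0"
    if v: "v \<in> tangent_space A x" "v \<noteq> (\<lambda>_. 0)" for x v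
  proof -
    define p where "p = (0::real, x)"
    define K where "K = K_field A p"
    define u where "u = horizontal_lift A p v"
    define r where "r = h p u K / h p K K"
    \<comment> \<open>the component of the lift that is \<open>h\<close>-orthogonal to \<open>K\<close>\<close>
    define z where "z = (\<lambda>e. 1 *\<^sub>R u e + (- r) *\<^sub>R K e)"
    have T: "u \<in> tangent_space (RS A) p" "K \<in> tangent_space (RS A) p"
      unfolding u_def K_def by (rule LT KT)+
    have zT: "z \<in> tangent_space (RS A) p"
      unfolding z_def by (rule tangent_space_combination[OF smooth_atlas_RS[OF A] T])
    have KK: "h p K K > 0" unfolding K_def by (rule hKK)
    obtain c where c: "c \<in> charts_at A x" using exists_chart_at[OF A] by blast
    have cp: "c \<in> charts_at A (snd p)" and vp: "v \<in> tangent_space A (snd p)"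
      using c v(1) by (simp_all add: p_def)
    have "v c \<noteq> 0"
      using tangent_vector_eqI[OF A c v(1) tangent_space_zero[OF A]] v(2) by blast
    then have "snd (z (cylinder_chart c)) \<noteq> 0"
      by (simp add: z_def u_def K_def horizontal_lift_component[OF A cp vp] K_field_component[OF A cp])
    then have "z \<noteq> (\<lambda>_. 0)" by auto
    then have "h p z z > 0" by (rule Stat_positive[OF h zT])
    also have "h p z z = h p u u - (h p u K)\<^sup>2 / h p K K"
    proof -
      note hs = Stat_sym_tensor2[OF h]
      have right: "h p e z = 1 * h p e u + (- r) * h p e K" if "e \<in> tangent_space (RS A) p" for e
        unfolding z_def by (rule sym_tensor2_right[OF smooth_atlas_RS[OF A] hs T that])
      have "h p z z = 1 * h p u z + (- r) * h p K z"
        using sym_tensor2_left[OF hs T zT, of 1 "- r"] by (simp only: z_def[symmetric])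
      also have "\<dots> = h p u u - 2 * r * h p u K + r * r * h p K K"
        using sym_tensor2_commute[OF hs T] by (simp add: right T algebra_simps)
      also have "\<dots> = h p u u - (h p u K)\<^sup>2 / h p K K"
        using KK by (simp add: r_def power2_eq_square field_simps)
      finally show ?thesis .
    qed
    also have "\<dots> = g\<^sub>0 x v v + 1 / \<beta> x * (\<omega> x v)\<^sup>2"
    proof -
      have "\<beta> x = h p K K" by (simp add: \<beta>_def gK K_def p_def)
      moreover have "\<omega> x v = - h p u K" using v(1) by (simp add: \<omega>_def gK K_def p_def u_def)
      moreover have "g\<^sub>0 x v v = h p u u - 2 * (h p u K * h p u K) / h p K K"
        using v(1) by (simp add: g\<^sub>0_def g_def Psi_def K_def p_def u_def)
      ultimately show ?thesis by (simp add: power2_eq_square field_simps)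
    qed
    finally show ?thesis .
  qed
  have form: "g (t, x) w w' =
             - \<beta> x * dt_form A (t, x) w * dt_form A (t, x) w'
             + dt_form A (t, x) w * \<omega> x (space_part A (t, x) w')
             + \<omega> x (space_part A (t, x) w) * dt_form A (t, x) w'
             + g\<^sub>0 x (space_part A (t, x) w) (space_part A (t, x) w')"
    if w: "w \<in> tangent_space (RS A) (t, x)" and w': "w' \<in> tangent_space (RS A) (t, x)" for t x w w'
    using space_part_in_tangent_space[OF A w] space_part_in_tangent_space[OF A w']
      time_independent_expansion[OF sym ti w w']
    by (simp add: \<beta>_def \<omega>_def g\<^sub>0_def)
  show ?thesis
    unfolding g_def[symmetric] SOM_def
    using lor smooth_\<beta> \<beta>_pos form_\<omega> sym_g\<^sub>0 pos form by blast
qed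

end

section \<open>The correspondence\<close>

theorem proposition4p1:
  fixes A :: "('s::{t2_space,second_countable_topology}, 'e::euclidean_space) chart set"
  assumes "smooth_atlas A"
  shows
    "(\<forall>g\<in>SOM A. \<forall>p. \<forall>w\<in>tangent_space (RS A) p.
        Psi A g p w w = g p w w - 2 * (g p w (K_field A p))\<^sup>2 / g p (K_field A p) (K_field A p))
   \<and> bij_betw (Psi A) (SOM A) (Stat\<^sub>R A)
   \<and> (\<forall>h\<in>Stat\<^sub>R A. \<forall>p. \<forall>w\<in>tangent_space (RS A) p.
        inv_into (SOM A) (Psi A) h p w w =
          h p w w - 2 * (h p w (K_field A p))\<^sup>2 / h p (K_field A p) (K_field A p))
   \<and> (\<forall>g\<in>SOM A. \<forall>h. h = Psi A g \<longrightarrow>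
        killing_field (RS A) g (K_field A) \<and> killing_field (RS A) h (K_field A)
      \<and> (\<forall>p. g p (K_field A p) (K_field A p) = - h p (K_field A p) (K_field A p))
      \<and> (\<forall>p. orthogonal_space (RS A) g (K_field A) p = orthogonal_space (RS A) h (K_field A) p
           \<and> (\<forall>v\<in>orthogonal_space (RS A) g (K_field A) p.
                \<forall>w\<in>orthogonal_space (RS A) g (K_field A) p. g p v w = h p v w))
      \<and> {\<psi>. conformal_map (RS A) h \<psi> \<and> preserves_field (RS A) (K_field A) \<psi>}
        = {\<psi>. conformal_map (RS A) g \<psi> \<and> preserves_field (RS A) (K_field A) \<psi>})"
proof -
  note K = K_field_in_tangent_space[OF assms]
  have square: "Psi A g p w w = g p w w - 2 * (g p w (K_field A p))\<^sup>2 / g p (K_field A p) (K_field A p)"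
    for g p w by (simp add: Psi_def power2_eq_square)
  have gKK: "g p (K_field A p) (K_field A p) \<noteq> 0" if "g \<in> SOM A" for g p
    using SOM_K_K[OF assms that, of p] by simp
  have hKK: "h p (K_field A p) (K_field A p) \<noteq> 0" if "h \<in> Stat\<^sub>R A" for h p
    using Stat_K_K[OF assms that, of p] by simp
  have inv1: "Psi A (Psi A g) = g" if "g \<in> SOM A" for g
    by (rule Psi_involution) (rule gKK[OF that])
  have inv2: "Psi A (Psi A h) = h" if "h \<in> Stat\<^sub>R A" for h
    by (rule Psi_involution) (rule hKK[OF that])
  have bij: "bij_betw (Psi A) (SOM A) (Stat\<^sub>R A)"
    by (rule bij_betw_byWitness[where f' = "Psi A"])
      (use inv1 inv2 SOM_Psi_in_Stat[OF assms] Stat_Psi_in_SOM[OF assms] in blast)+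
  have inverse: "inv_into (SOM A) (Psi A) h = Psi A h" if h: "h \<in> Stat\<^sub>R A" for h
    using inv_into_f_f[OF bij_betw_imp_inj_on[OF bij] Stat_Psi_in_SOM[OF assms h]] inv2[OF h] by simp
  have same: "killing_field (RS A) g (K_field A) \<and> killing_field (RS A) (Psi A g) (K_field A)
      \<and> (\<forall>p. g p (K_field A p) (K_field A p) = - Psi A g p (K_field A p) (K_field A p))
      \<and> (\<forall>p. orthogonal_space (RS A) g (K_field A) p = orthogonal_space (RS A) (Psi A g) (K_field A) p
           \<and> (\<forall>v\<in>orthogonal_space (RS A) g (K_field A) p.
                \<forall>w\<in>orthogonal_space (RS A) g (K_field A) p. g p v w = Psi A g p v w))
      \<and> {\<psi>. conformal_map (RS A) (Psi A g) \<psi> \<and> preserves_field (RS A) (K_field A) \<psi>}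
        = {\<psi>. conformal_map (RS A) g \<psi> \<and> preserves_field (RS A) (K_field A) \<psi>}"
    if g: "g \<in> SOM A" for g
  proof (intro conjI allI ballI)
    show "killing_field (RS A) g (K_field A)"
      using killing_field_iff_time_independent[OF assms SOM_sym_tensor2[OF assms g]]
        SOM_time_independent[OF assms g] by blast
    show "killing_field (RS A) (Psi A g) (K_field A)"
      using SOM_Psi_in_Stat[OF assms g] by (simp add: Stat\<^sub>R_def)
    have gK: "Psi A g p v (K_field A p) = - g p v (K_field A p)" for p v
      by (rule Psi_K_right) (rule gKK[OF g])
    show "g p (K_field A p) (K_field A p) = - Psi A g p (K_field A p) (K_field A p)" for p
      by (simp add: gK)
    show "orthogonal_space (RS A) g (K_field A) p = orthogonal_space (RS A) (Psi A g) (K_field A) p" for p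
      by (simp add: orthogonal_space_def gK)
    show "g p v w = Psi A g p v w"
      if "v \<in> orthogonal_space (RS A) g (K_field A) p" for p v w
      using that by (simp add: orthogonal_space_def Psi_def)
    show "{\<psi>. conformal_map (RS A) (Psi A g) \<psi> \<and> preserves_field (RS A) (K_field A) \<psi>}
        = {\<psi>. conformal_map (RS A) g \<psi> \<and> preserves_field (RS A) (K_field A) \<psi>}"
      using Psi_conformal_map[OF K, of g] Psi_conformal_map[OF K, of "Psi A g"] inv1[OF g] by auto
  qed
  show ?thesis
    using square bij inverse same by simp
qed

end
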